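(* Let $n\ge1$ be an integer, $\alpha,\beta\in(0,1)$, and $\omega(t)=1/(1-t)^{1-\beta}$ for $t\in[0,1)$. Let $\phi:\mathbb{B}^n\to\mathbb{D}$ be holomorphic. Then: (1) $C_\phi:\mathscr{L}_\alpha(\mathbb{D})\cap\mathscr{PH}(\mathbb{D})\to\mathscr{L}_\beta(\mathbb{B}^n)\cap\mathscr{PH}(\mathbb{B}^n)$ is bounded if and only if $$\sup_{k\ge1}\left\{k^{-\alpha}\|\phi^k\|_{\mathscr{B}_\omega(\mathbb{B}^n)}\right\}<\infty;$$ (2) $C_\phi:\mathscr{L}_\alpha(\mathbb{D})\cap\mathscr{PH}(\mathbb{D})\to\mathscr{L}_\beta(\mathbb{B}^n)\cap\mathscr{PH}(\mathbb{B}^n)$ is compact if and only if $$\lim_{k\to\infty}\left\{k^{-\alpha}\|\phi^k\|_{\mathscr{B}_\omega(\mathbb{B}^n)}\right\}=0.$$ Here $k$ ranges over the positive integers.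
   Context: $\langle z,w\rangle=\sum_k z_k\overline{w}_k$ and $|z|=\langle z,z\rangle^{1/2}$ on $\mathbb{C}^n$; $\mathbb{B}^n$ is the open unit ball of $\mathbb{C}^n$, $\mathbb{D}=\mathbb{B}^1$. $\phi^k$ denotes the $k$-th power (pointwise product) of $\phi$. A twice continuously differentiable $f:\mathbb{B}^n\to\mathbb{C}$ is pluriharmonic if its restriction to every complex line (intersected with $\mathbb{B}^n$) is harmonic; equivalently $f=h+\overline g$ with $h,g$ holomorphic on $\mathbb{B}^n$. For $n=1$ pluriharmonic means complex-valued harmonic. $\mathscr{PH}(\mathbb{B}^n)$ is the set of pluriharmonic functions $\mathbb{B}^n\to\mathbb{C}$. Lipschitz space: for $\alpha\in(0,1]$, $\mathscr{L}_\alpha(\mathbb{B}^n)$ is the set of continuous $f:\mathbb{B}^n\to\mathbb{C}$ with $\|f\|_{\mathscr{L}_\alpha(\mathbb{B}^n),s}:=\sup_{z\ne w\in\mathbb{B}^n}|f(z)-f(w)|/|z-w|^\alpha<\infty$; it is equipped with the norm $|f(0)|+\|f\|_{\mathscr{L}_\alpha(\mathbb{B}^n),s}$. $\mathscr{L}_\alpha(\mathbb{D})$ is the case $n=1$. Bloch type space: for pluriharmonic $f$, $\nabla f=(\partial f/\partial z_1,\dots,\partial f/\partial z_n)$, $\overline\nabla f=(\partial f/\partial\overline z_1,\dots,\partial f/\partial\overline z_n)$, $\Lambda_f(z)=\max_{\theta\in\partial\mathbb{B}^n}|\langle\nabla f(z),\overline\theta\rangle+\langle\overline\nabla f(z),\theta\rangle|$,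 and $\|f\|_{\mathscr{B}_\omega(\mathbb{B}^n)}:=|f(0)|+\sup_{z\in\mathbb{B}^n}\Lambda_f(z)/\omega(|z|)$ (possibly $\infty$). Composition operator: $C_\phi(f)=f\circ\phi$. "Bounded" and "compact" mean that $C_\phi$ maps the first space into the second and is a bounded, respectively compact, linear operator between these normed spaces.
   Formalization: In (2) the limit condition also requires every norm of φ^k (k≥1) to be finite; if infinite terms were allowed, the claim would fail for n=1, β=3/4, φ(z)=√(1−z)/2. *)

theory Defs
  imports "HOL-Analysis.Analysis"
begin

text \<open>
  Functions on a ball are represented by total functions of which only the values on
  the ball matter. Accordingly, all function spaces and norms below depend only on those
  values, and equality in these spaces is equality on the ball. The unit disc is
  \<open>ball 0 1 :: complex set\<close> and the unit ball of complex n-space is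
  \<open>ball 0 1 :: (complex ^ 'n) set\<close>, whose norm is the Euclidean one.
\<close>

subsection \<open>Holomorphic, harmonic and pluriharmonic functions\<close>

definition cn_holomorphic_on :: "(complex ^ 'n \<Rightarrow> complex) \<Rightarrow> (complex ^ 'n) set \<Rightarrow> bool" where
  "cn_holomorphic_on f S \<longleftrightarrow>
     (\<forall>z\<in>S. \<exists>A. (f has_derivative A) (at z) \<and> (\<forall>c v. A (c *s v) = c * A v))"

text \<open>Twice continuous differentiability in the real sense, for open \<open>S\<close>.\<close>

definition C2_on :: "('a::real_normed_vector \<Rightarrow> 'b::real_normed_vector) \<Rightarrow> 'a set \<Rightarrow> bool" where
  "C2_on f S \<longleftrightarrow>
     (\<exists>(f' :: 'a \<Rightarrow> 'a \<Rightarrow>\<^sub>L 'b) (f'' :: 'a \<Rightarrow> 'a \<Rightarrow>\<^sub>L ('a \<Rightarrow>\<^sub>L 'b)).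
        (\<forall>x\<in>S. (f has_derivative blinfun_apply (f' x)) (at x)) \<and>
        (\<forall>x\<in>S. (f' has_derivative blinfun_apply (f'' x)) (at x)) \<and>
        continuous_on S f'')"

definition dir_deriv ::
    "('a::real_normed_vector \<Rightarrow> 'b::real_normed_vector) \<Rightarrow> 'a \<Rightarrow> 'a \<Rightarrow> 'b" where
  "dir_deriv f v z = vector_derivative (\<lambda>t::real. f (z + t *\<^sub>R v)) (at 0)"

definition laplacian :: "(complex \<Rightarrow> complex) \<Rightarrow> complex \<Rightarrow> complex" where
  "laplacian f z = dir_deriv (dir_deriv f 1) 1 z + dir_deriv (dir_deriv f \<i>) \<i> z"

definition harmonic_on :: "(complex \<Rightarrow> complex) \<Rightarrow> complex set \<Rightarrow> bool" where
  "harmonic_on f S \<longleftrightarrow> C2_on f S \<and> (\<forall>z\<in>S. laplacian f z = 0)"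

definition pluriharmonic_on :: "(complex ^ 'n \<Rightarrow> complex) \<Rightarrow> (complex ^ 'n) set \<Rightarrow> bool" where
  "pluriharmonic_on f S \<longleftrightarrow> C2_on f S \<and>
     (\<forall>a b. b \<noteq> 0 \<longrightarrow> harmonic_on (\<lambda>\<zeta>. f (a + \<zeta> *s b)) {\<zeta>. a + \<zeta> *s b \<in> S})"

definition PH_disc :: "(complex \<Rightarrow> complex) set" where
  "PH_disc = {f. harmonic_on f (ball 0 1)}"

definition PH_ball :: "(complex ^ 'n \<Rightarrow> complex) set" where
  "PH_ball = {f. pluriharmonic_on f (ball 0 1)}"


subsection \<open>Lipschitz spaces\<close>

text \<open>Stated for the unit ball of any normed space, so as to cover both the disc and the ball.\<close>

definition lip_quotients :: "real \<Rightarrow> ('a::real_normed_vector \<Rightarrow> complex) \<Rightarrow> real set" where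
  "lip_quotients \<alpha> f =
     {norm (f z - f w) / norm (z - w) powr \<alpha> | z w. z \<in> ball 0 1 \<and> w \<in> ball 0 1 \<and> z \<noteq> w}"

definition lip_space :: "real \<Rightarrow> ('a::real_normed_vector \<Rightarrow> complex) set" where
  "lip_space \<alpha> = {f. continuous_on (ball 0 1) f \<and> bdd_above (lip_quotients \<alpha> f)}"

definition lip_norm :: "real \<Rightarrow> ('a::real_normed_vector \<Rightarrow> complex) \<Rightarrow> real" where
  "lip_norm \<alpha> f = norm (f 0) + Sup (lip_quotients \<alpha> f)"


subsection \<open>The Bloch type norm\<close>

definition herm_inner :: "complex ^ 'n \<Rightarrow> complex ^ 'n \<Rightarrow> complex" where
  "herm_inner z w = (\<Sum>k\<in>UNIV. z $ k * cnj (w $ k))"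

text \<open>Gradients made of the Wirtinger derivatives; \<open>axis k 1\<close> and \<open>axis k \<i>\<close> are the real
  directions \<open>x\<^sub>k\<close> and \<open>y\<^sub>k\<close>, where \<open>z\<^sub>k = x\<^sub>k + \<i> y\<^sub>k\<close>.\<close>

definition grad :: "(complex ^ 'n \<Rightarrow> complex) \<Rightarrow> complex ^ 'n \<Rightarrow> complex ^ 'n" where
  "grad f z = (\<chi> k. (dir_deriv f (axis k 1) z - \<i> * dir_deriv f (axis k \<i>) z) / 2)"

definition grad_bar :: "(complex ^ 'n \<Rightarrow> complex) \<Rightarrow> complex ^ 'n \<Rightarrow> complex ^ 'n" where
  "grad_bar f z = (\<chi> k. (dir_deriv f (axis k 1) z + \<i> * dir_deriv f (axis k \<i>) z) / 2)"

text \<open>The supremum is a maximum: a continuous function on the compact unit sphere.\<close>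

definition Lambda :: "(complex ^ 'n \<Rightarrow> complex) \<Rightarrow> complex ^ 'n \<Rightarrow> real" where
  "Lambda f z = (SUP \<theta>\<in>sphere 0 1.
     norm (herm_inner (grad f z) (\<chi> k. cnj (\<theta> $ k)) + herm_inner (grad_bar f z) \<theta>))"

definition bloch_norm :: "(real \<Rightarrow> real) \<Rightarrow> (complex ^ 'n \<Rightarrow> complex) \<Rightarrow> ennreal" where
  "bloch_norm \<omega> f =
     ennreal (norm (f 0)) + (SUP z\<in>ball 0 1. ennreal (Lambda f z / \<omega> (norm z)))"


subsection \<open>Bounded and compact operators between spaces of functions\<close>

text \<open>A space is given by its carrier \<open>X\<close> and its norm \<open>p\<close>.\<close>

definition linear_operator ::
    "('a \<Rightarrow> complex) set \<Rightarrow> ('b \<Rightarrow> complex) set \<Rightarrow> (('a \<Rightarrow> complex) \<Rightarrow> 'b \<Rightarrow> complex) \<Rightarrow> bool" where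
  "linear_operator X Y T \<longleftrightarrow> (\<forall>f\<in>X. T f \<in> Y) \<and>
     (\<forall>f\<in>X. \<forall>g\<in>X. \<forall>a b. T (\<lambda>z. a * f z + b * g z) = (\<lambda>z. a * T f z + b * T g z))"

definition bounded_operator ::
    "('a \<Rightarrow> complex) set \<Rightarrow> (('a \<Rightarrow> complex) \<Rightarrow> real) \<Rightarrow> ('b \<Rightarrow> complex) set \<Rightarrow>
     (('b \<Rightarrow> complex) \<Rightarrow> real) \<Rightarrow> (('a \<Rightarrow> complex) \<Rightarrow> 'b \<Rightarrow> complex) \<Rightarrow> bool" where
  "bounded_operator X p Y q T \<longleftrightarrow> linear_operator X Y T \<and>
     (\<exists>C. \<forall>f\<in>X. q (T f) \<le> C * p f)"

text \<open>Compactness: every bounded sequence is mapped to a sequence having a subsequence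
  that converges in the target space.\<close>

definition compact_operator ::
    "('a \<Rightarrow> complex) set \<Rightarrow> (('a \<Rightarrow> complex) \<Rightarrow> real) \<Rightarrow> ('b \<Rightarrow> complex) set \<Rightarrow>
     (('b \<Rightarrow> complex) \<Rightarrow> real) \<Rightarrow> (('a \<Rightarrow> complex) \<Rightarrow> 'b \<Rightarrow> complex) \<Rightarrow> bool" where
  "compact_operator X p Y q T \<longleftrightarrow> linear_operator X Y T \<and>
     (\<forall>F :: nat \<Rightarrow> 'a \<Rightarrow> complex. (\<forall>j. F j \<in> X) \<and> (\<exists>M. \<forall>j. p (F j) \<le> M) \<longrightarrow>
        (\<exists>(r :: nat \<Rightarrow> nat) g. strict_mono r \<and> g \<in> Y \<and>
           (\<lambda>j. q (\<lambda>z. T (F (r j)) z - g z)) \<longlonglongrightarrow> 0))"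

definition comp_operator :: "('b \<Rightarrow> 'a) \<Rightarrow> ('a \<Rightarrow> complex) \<Rightarrow> 'b \<Rightarrow> complex" where
  "comp_operator \<phi> f = f \<circ> \<phi>"

end

theory Submission
  imports Defs "HOL-Complex_Analysis.Great_Picard"
begin

text \<open>
  A harmonic function on the disc is \<open>h + cnj g\<close> with \<open>h\<close>, \<open>g\<close> holomorphic, and if it is
  \<open>\<alpha>\<close>-Lipschitz then \<open>h'\<close> and \<open>g'\<close> grow at most like \<open>(1 - \<bar>w\<bar>) powr (\<alpha> - 1)\<close>, by a
  Borel--Caratheodory estimate; conversely, growth like \<open>(1 - \<bar>z\<bar>) powr (\<beta> - 1)\<close> of the
  derivative on the ball implies the \<open>\<beta>\<close>-Lipschitz condition (Hardy--Littlewood). Hence both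
  properties of the composition operator are governed by
  \<open>(1 - \<bar>\<phi> z\<bar>) powr (\<alpha> - 1) * \<bar>D\<phi> z\<bar> * (1 - \<bar>z\<bar>) powr (1 - \<beta>)\<close>,
  which must be bounded, respectively small where \<open>\<bar>\<phi> z\<bar>\<close> is close to 1. The powers
  \<open>\<phi>^k\<close> detect exactly this: for \<open>\<bar>\<phi> z\<bar> = r\<close> the factor \<open>k powr (1 - \<alpha>) * r^(k - 1)\<close> is
  comparable to \<open>(1 - r) powr (\<alpha> - 1)\<close> when \<open>k\<close> is about \<open>1 / (1 - r)\<close>. Sufficiency for
  compactness uses Montel's theorem to extract a locally uniformly convergent subsequence;
  necessity tests the operator on the bounded sequence of the functions
  \<open>k powr (- \<alpha>) * w^k\<close>, which tends to 0 pointwise.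
\<close>

subsection \<open>Harmonic functions on the disc\<close>

text \<open>The definitions are of real-variable type: (pluri)harmonicity asks for C2 regularity,
  and holomorphy in several variables only for a complex linear derivative at each point. This
  shapes the first half. Splitting a harmonic function needs symmetry of the second Frechet
  derivative, because the mixed derivative enters the Cauchy-Riemann equations for its Wirtinger
  derivative. That \<open>f \<circ> \<phi>\<close> is pluriharmonic needs C2 regularity of functions
  whose derivative is not assumed continuous; partial derivatives are therefore written as Cauchy
  integrals over circles, which yields first their continuity and then their differentiability under
  the integral sign. The splitting also carries the estimates: \<open>f\<close> itself has no
  complex derivative, but \<open>h\<close> and \<open>g\<close> do, and the derivative of
  \<open>f \<circ> \<phi>\<close> at \<open>z\<close> in direction \<open>v\<close> is at most
  \<open>(norm (deriv h (\<phi> z)) + norm (deriv g (\<phi> z))) * norm (D z v)\<close>.\<close>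

lemma holomorphic_onI_DERIV:
  assumes "open S" "\<And>z. z \<in> S \<Longrightarrow> (f has_field_derivative f' z) (at z)"
  shows "f holomorphic_on S"
  using assms by (auto simp: holomorphic_on_open)

text \<open>The mean value inequality is applied to \<open>G\<close>, the increment of
  \<open>f\<close> in direction \<open>v\<close> along the segment from \<open>x\<close> to
  \<open>x + u\<close>, minus the expected mixed term. Its derivative is the difference of two
  first-order remainders of \<open>f'\<close>, of sizes \<open>e * (norm u + norm v)\<close> and
  \<open>e * norm u\<close>; their sum gives the factor \<open>2 * norm u + norm v\<close>. The
  radius \<open>d / 3\<close> keeps all points in the ball.\<close>

lemma second_difference_bound:
  fixes f :: "'a::real_normed_vector \<Rightarrow> 'b::real_normed_vector"
  assumes f: "\<And>y. y \<in> ball x d \<Longrightarrow> (f has_derivative blinfun_apply (f' y)) (at y)"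
    and rem: "\<And>y. y \<in> ball x d \<Longrightarrow> norm (f' y - f' x - f'' (y - x)) \<le> e * norm (y - x)"
    and lin: "bounded_linear f''" and e: "e > 0"
    and u: "norm u \<le> d / 3" and v: "norm v \<le> d / 3" and d: "d > 0"
  shows "norm (f (x + u + v) - f (x + u) - f (x + v) + f x - f'' v u)
          \<le> e * (2 * norm u + norm v) * norm u"
proof -
  interpret f'': bounded_linear f'' by (fact lin)
  define G where "G = (\<lambda>t::real. f (x + t *\<^sub>R u + v) - f (x + t *\<^sub>R u) - t *\<^sub>R (f'' v u))"
  define G' where "G' = (\<lambda>t::real. blinfun_apply (f' (x + t *\<^sub>R u + v)) u - blinfun_apply (f' (x + t *\<^sub>R u)) u - f'' v u)"
  have in1: "x + t *\<^sub>R u + v \<in> ball x d" if "t \<in> {0..1}" for t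
  proof -
    have "norm (t *\<^sub>R u) \<le> norm u" using that by (auto simp: mult_left_le_one_le)
    then have "norm (t *\<^sub>R u + v) \<le> d/3 + d/3"
      using u v norm_triangle_ineq[of "t *\<^sub>R u" v] by linarith
    moreover have "dist x (x + t *\<^sub>R u + v) = norm (t *\<^sub>R u + v)"
      by (metis add.assoc add_diff_cancel_left' dist_commute dist_norm)
    ultimately show ?thesis using d by simp
  qed
  have in2: "x + t *\<^sub>R u \<in> ball x d" if "t \<in> {0..1}" for t
  proof -
    have "norm (t *\<^sub>R u) \<le> norm u" using that by (auto simp: mult_left_le_one_le)
    with u have "norm (t *\<^sub>R u) \<le> d/3" by linarith
    then show ?thesis using d by (simp add: dist_norm norm_minus_commute add.assoc)
  qed
  have der: "(G has_derivative (\<lambda>s. s *\<^sub>R G' t)) (at t within {0..1})" if t: "t \<in> {0..1}" for t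
  proof -
    have fl: "((\<lambda>t. f (c + t *\<^sub>R u)) has_derivative (\<lambda>s. s *\<^sub>R blinfun_apply (f' (c + t *\<^sub>R u)) u)) (at t within {0..1})"
      if c: "c + t *\<^sub>R u \<in> ball x d" for c
      by (rule has_derivative_eq_rhs[OF has_derivative_compose[where f="\<lambda>t. c + t *\<^sub>R u" and g=f, OF _ f[OF c]]])
         (auto intro!: derivative_eq_intros simp: blinfun.scaleR_right)
    have eq: "x + s *\<^sub>R u + v = (x + v) + s *\<^sub>R u" for s by simp
    have "((\<lambda>t. t *\<^sub>R f'' v u) has_derivative (\<lambda>s. s *\<^sub>R f'' v u)) (at t within {0..1})"
      by (auto intro!: derivative_eq_intros)
    with in1[OF t] in2[OF t] have "(G has_derivative (\<lambda>s. s *\<^sub>R blinfun_apply (f' (x + v + t *\<^sub>R u)) u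
        - s *\<^sub>R blinfun_apply (f' (x + t *\<^sub>R u)) u - s *\<^sub>R f'' v u)) (at t within {0..1})"
      unfolding G_def eq by (intro has_derivative_diff fl)
    then show ?thesis unfolding G'_def eq by (simp only: scaleR_diff_right)
  qed
  have bound: "norm (G' t) \<le> e * (2 * norm u + norm v) * norm u" if t: "t \<in> {0..1}" for t
  proof -
    define A where "A = f' (x + t *\<^sub>R u + v) - f' x - f'' (x + t *\<^sub>R u + v - x)"
    define B where "B = f' (x + t *\<^sub>R u) - f' x - f'' (x + t *\<^sub>R u - x)"
    have tu: "norm (t *\<^sub>R u) \<le> norm u" using t by (auto simp: mult_left_le_one_le)
    have "G' t = blinfun_apply A u - blinfun_apply B u"
      unfolding G'_def A_def B_def
      by (simp add: blinfun.diff_left blinfun.add_left f''.add algebra_simps)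
    also have "norm \<dots> \<le> norm A * norm u + norm B * norm u"
      by (intro order.trans[OF norm_triangle_ineq4] add_mono norm_blinfun)
    also have "norm A \<le> e * (norm u + norm v)"
    proof -
      have "norm A \<le> e * norm (t *\<^sub>R u + v)"
        using rem[OF in1[OF t]] unfolding A_def by (simp add: algebra_simps)
      also have "norm (t *\<^sub>R u + v) \<le> norm u + norm v" using tu norm_triangle_ineq[of "t *\<^sub>R u" v] by linarith
      finally show ?thesis using e by simp
    qed
    also have "norm B \<le> e * norm u"
    proof -
      have "norm B \<le> e * norm (t *\<^sub>R u)"
        using rem[OF in2[OF t]] unfolding B_def by (simp add: algebra_simps)
      also have "\<dots> \<le> e * norm u" using tu e by (intro mult_left_mono) auto
      finally show ?thesis .
    qed
    finally show ?thesis by (simp add: algebra_simps mult_right_mono)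
  qed
  have on: "onorm (\<lambda>s::real. s *\<^sub>R G' t) \<le> e * (2 * norm u + norm v) * norm u" if t: "t \<in> {0..1}" for t
  proof (rule onorm_bound)
    show "0 \<le> e * (2 * norm u + norm v) * norm u" using e by simp
    show "norm (s *\<^sub>R G' t) \<le> e * (2 * norm u + norm v) * norm u * norm s" for s
      using mult_left_mono[OF bound[OF t], of "norm s"] by (simp add: mult_ac)
  qed
  have "norm (G 1 - G 0) \<le> e * (2 * norm u + norm v) * norm u * norm (1 - 0::real)"
    by (rule differentiable_bound[where S="{0..1}" and f'="\<lambda>t s. s *\<^sub>R G' t"])
       (use der on in auto)
  then show ?thesis by (simp add: G_def algebra_simps)
qed

text \<open>The second difference of \<open>f\<close> is symmetric in \<open>u\<close> and
  \<open>v\<close>, while the previous lemma compares it with \<open>f'' v u\<close> in one order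
  and with \<open>f'' u v\<close> in the other. After scaling both vectors by \<open>s\<close>,
  terms and errors are quadratic in \<open>s\<close>, so division by \<open>s^2\<close> leaves an
  error proportional to \<open>e\<close>.\<close>

lemma second_derivative_symmetric:
  fixes f :: "'a::real_normed_vector \<Rightarrow> 'b::real_normed_vector"
  assumes S: "open S" "x \<in> S"
    and f: "\<And>y. y \<in> S \<Longrightarrow> (f has_derivative blinfun_apply (f' y)) (at y)"
    and f'': "(f' has_derivative blinfun_apply f'') (at x)"
  shows "f'' u v = f'' v u"
proof -
  have key: "norm (f'' v u - f'' u v) \<le> e * (2 * (norm u + norm v)^2)" if e: "e > 0" for e
  proof -
    from f'' have "\<exists>d>0. \<forall>y. norm (y - x) < d \<longrightarrow> norm (f' y - f' x - f'' (y - x)) \<le> e * norm (y - x)"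
      using e unfolding has_derivative_at_alt by blast
    then obtain d1 where d1: "d1 > 0" "\<And>y. norm (y - x) < d1 \<Longrightarrow> norm (f' y - f' x - f'' (y - x)) \<le> e * norm (y - x)"
      by blast
    obtain d2 where d2: "d2 > 0" "ball x d2 \<subseteq> S" using S open_contains_ball by blast
    define d where "d = min d1 d2"
    have d: "d > 0" using d1 d2 by (simp add: d_def)
    have A: "(f has_derivative blinfun_apply (f' y)) (at y)" if "y \<in> ball x d" for y
      using that d2 f by (auto simp: d_def)
    have B: "norm (f' y - f' x - f'' (y - x)) \<le> e * norm (y - x)" if "y \<in> ball x d" for y
      using that d1(2)[of y] by (simp add: d_def dist_norm norm_minus_commute[of x])
    \<comment> \<open>The summand 1 keeps the denominator positive when \<open>u\<close> and
      \<open>v\<close> vanish.\<close>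
    define s where "s = d / (3 * (norm u + norm v + 1))"
    have s: "s > 0" using d by (simp add: s_def add_nonneg_pos)
    have small: "norm (s *\<^sub>R w) \<le> d / 3" if "norm w \<le> norm u + norm v + 1" for w :: 'a
    proof -
      have "norm (s *\<^sub>R w) = s * norm w" using s by simp
      also have "\<dots> \<le> s * (norm u + norm v + 1)" using s that by (intro mult_left_mono) auto
      also have "\<dots> = d / 3" using s unfolding s_def by (auto simp: divide_simps)
      finally show ?thesis .
    qed
    have su: "norm (s *\<^sub>R u) \<le> d / 3" and sv: "norm (s *\<^sub>R v) \<le> d / 3"
      by (rule small, simp)+
    have 1: "norm (f (x + s *\<^sub>R u + s *\<^sub>R v) - f (x + s *\<^sub>R u) - f (x + s *\<^sub>R v) + f x - f'' (s *\<^sub>R v) (s *\<^sub>R u))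
          \<le> e * (2 * norm (s *\<^sub>R u) + norm (s *\<^sub>R v)) * norm (s *\<^sub>R u)"
      by (rule second_difference_bound[OF A B _ e su sv d]) (simp_all add: blinfun.bounded_linear_right)
    have 2: "norm (f (x + s *\<^sub>R v + s *\<^sub>R u) - f (x + s *\<^sub>R v) - f (x + s *\<^sub>R u) + f x - f'' (s *\<^sub>R u) (s *\<^sub>R v))
          \<le> e * (2 * norm (s *\<^sub>R v) + norm (s *\<^sub>R u)) * norm (s *\<^sub>R v)"
      by (rule second_difference_bound[OF A B _ e sv su d]) (simp_all add: blinfun.bounded_linear_right)
    have eq: "s^2 *\<^sub>R (f'' v u - f'' u v) =
        (f (x + s *\<^sub>R v + s *\<^sub>R u) - f (x + s *\<^sub>R v) - f (x + s *\<^sub>R u) + f x - f'' (s *\<^sub>R u) (s *\<^sub>R v))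
        - (f (x + s *\<^sub>R u + s *\<^sub>R v) - f (x + s *\<^sub>R u) - f (x + s *\<^sub>R v) + f x - f'' (s *\<^sub>R v) (s *\<^sub>R u))"
      by (simp add: blinfun.scaleR_left blinfun.scaleR_right algebra_simps power2_eq_square)
    have "s^2 * norm (f'' v u - f'' u v) = norm (s^2 *\<^sub>R (f'' v u - f'' u v))" by simp
    also have "\<dots> \<le> e * (2 * norm (s *\<^sub>R v) + norm (s *\<^sub>R u)) * norm (s *\<^sub>R v) + e * (2 * norm (s *\<^sub>R u) + norm (s *\<^sub>R v)) * norm (s *\<^sub>R u)"
      unfolding eq by (rule order.trans[OF norm_triangle_ineq4 add_mono[OF 2 1]])
    also have "\<dots> = s^2 * (e * ((2 * norm v + norm u) * norm v + (2 * norm u + norm v) * norm u))"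
      using s by (simp add: algebra_simps power2_eq_square)
    also have "\<dots> \<le> s^2 * (e * (2 * (norm u + norm v)^2))"
      using s e by (intro mult_left_mono) (simp_all add: algebra_simps power2_eq_square)
    finally show ?thesis using s by simp
  qed
  have "norm (f'' v u - f'' u v) \<le> 0"
  proof (rule field_le_epsilon)
    fix e :: real assume e: "e > 0"
    define K where "K = 2 * (norm u + norm v)^2"
    have K: "K \<ge> 0" by (simp add: K_def)
    have "norm (f'' v u - f'' u v) \<le> e / (K + 1) * K"
      using key[of "e / (K + 1)"] e K by (simp add: K_def add_nonneg_pos)
    also have "\<dots> \<le> e" using e K by (simp add: divide_simps)
    finally show "norm (f'' v u - f'' u v) \<le> 0 + e" by simp
  qed
  then show ?thesis by simp
qed

section \<open>Directional derivatives and the decomposition of harmonic functions\<close>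

lemma dir_deriv_eq:
  assumes "(f has_derivative A) (at z)"
  shows "dir_deriv f v z = A v"
proof -
  have f: "(f has_derivative A) (at (z + 0 *\<^sub>R v))" using assms by simp
  interpret bounded_linear A using assms by (rule has_derivative_bounded_linear)
  have "((\<lambda>t::real. f (z + t *\<^sub>R v)) has_vector_derivative A v) (at 0)"
    unfolding has_vector_derivative_def
    by (rule has_derivative_eq_rhs[OF has_derivative_compose[where f="\<lambda>t. z + t *\<^sub>R v" and g=f, OF _ f]])
       (auto intro!: derivative_eq_intros simp: scaleR)
  then show ?thesis unfolding dir_deriv_def by (rule vector_derivative_at)
qed

text \<open>A second directional derivative differentiates the total function
  \<open>dir_deriv f v\<close>, for which a formula is known only on an open set; locality allows
  that formula to be substituted.\<close>

lemma dir_deriv_cong: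
  assumes "open S" "z \<in> S" "\<And>w. w \<in> S \<Longrightarrow> f w = g w"
  shows "dir_deriv f v z = dir_deriv g v z"
proof -
  have o: "open ((\<lambda>t::real. z + t *\<^sub>R v) -` S)"
    by (intro open_vimage assms continuous_intros)
  have "\<forall>\<^sub>F t::real in nhds 0. f (z + t *\<^sub>R v) = g (z + t *\<^sub>R v)"
    unfolding eventually_nhds using assms by (intro exI[of _ "(\<lambda>t::real. z + t *\<^sub>R v) -` S"] conjI o) auto
  then show ?thesis unfolding dir_deriv_def
    by (intro vector_derivative_cong_eq) (auto simp: assms)
qed

lemma has_derivative_imp_has_field_derivative_complex:
  fixes f :: "complex \<Rightarrow> complex"
  assumes f: "(f has_derivative A) (at z)" and CR: "A \<i> = \<i> * A 1"
  shows "(f has_field_derivative A 1) (at z)"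
proof -
  interpret bounded_linear A using f by (rule has_derivative_bounded_linear)
  have "A v = A 1 * v" for v
  proof -
    have "A v = A (Re v *\<^sub>R 1 + Im v *\<^sub>R \<i>)"
      by (rule arg_cong[where f = A]) (simp add: complex_eq_iff)
    also have "\<dots> = Re v *\<^sub>R A 1 + Im v *\<^sub>R (\<i> * A 1)" by (simp only: add scaleR CR)
    also have "\<dots> = A 1 * v" by (simp add: complex_eq_iff algebra_simps)
    finally show ?thesis .
  qed
  then have "A = (*) (A 1)" by blast
  with f show ?thesis unfolding has_field_derivative_def by simp
qed

text \<open>Symmetry of \<open>f''\<close> and the Laplace equation together are the Cauchy-Riemann
  equations for \<open>p\<close>. On the convex disc \<open>p\<close> has a primitive
  \<open>h\<close>, and what remains, \<open>f - h\<close>, is antiholomorphic.\<close>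

lemma harmonic_imp_holomorphic_plus_cnj:
  assumes f: "harmonic_on f (ball 0 1)"
  obtains h g where "h holomorphic_on ball 0 1" "g holomorphic_on ball 0 1"
    "\<And>z. z \<in> ball 0 1 \<Longrightarrow> f z = h z + cnj (g z)"
proof -
  let ?D = "ball 0 1 :: complex set"
  from f obtain f' f'' where f': "\<And>x. x \<in> ?D \<Longrightarrow> (f has_derivative blinfun_apply (f' x)) (at x)"
    and f'': "\<And>x. x \<in> ?D \<Longrightarrow> (f' has_derivative blinfun_apply (f'' x)) (at x)"
    unfolding harmonic_on_def C2_on_def by blast
  have dd: "dir_deriv (dir_deriv f v) v z = f'' z v v" if z: "z \<in> ?D" for z v
  proof -
    have "dir_deriv (dir_deriv f v) v z = dir_deriv (\<lambda>w. blinfun_apply (f' w) v) v z"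
      by (rule dir_deriv_cong[of ?D]) (use z f' in \<open>auto intro!: dir_deriv_eq\<close>)
    also have "\<dots> = f'' z v v"
      by (rule dir_deriv_eq[where A = "\<lambda>u. f'' z u v"])
         (use f''[OF z] in \<open>auto intro!: derivative_eq_intros\<close>)
    finally show ?thesis .
  qed
  have lap: "f'' z 1 1 + f'' z \<i> \<i> = 0" if "z \<in> ?D" for z
    using f that unfolding harmonic_on_def laplacian_def dd[OF that, symmetric] by blast
  \<comment> \<open>\<open>p\<close> and \<open>q\<close> are the Wirtinger derivatives, so
    \<open>f' z v = p z * v + q z * cnj v\<close>.\<close>
  define p where "p = (\<lambda>z. (blinfun_apply (f' z) 1 - \<i> * blinfun_apply (f' z) \<i>) / 2)"
  define q where "q = (\<lambda>z. (blinfun_apply (f' z) 1 + \<i> * blinfun_apply (f' z) \<i>) / 2)"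
  have p: "(p has_field_derivative (f'' z 1 1 - \<i> * f'' z 1 \<i>) / 2) (at z)" if z: "z \<in> ?D" for z
  proof -
    let ?A = "\<lambda>v. (f'' z v 1 - \<i> * f'' z v \<i>) / 2"
    have d: "(p has_derivative ?A) (at z)"
      unfolding p_def using f''[OF z] by (auto intro!: derivative_eq_intros)
    have "f'' z \<i> 1 = f'' z 1 \<i>"
      by (rule second_derivative_symmetric[OF _ z f' f''[OF z]]) auto
    moreover have "f'' z \<i> \<i> = - f'' z 1 1" using lap[OF z] by (simp add: add_eq_0_iff2)
    ultimately have "?A \<i> = \<i> * ?A 1" by (simp add: algebra_simps diff_divide_distrib)
    from has_derivative_imp_has_field_derivative_complex[OF d this] show ?thesis .
  qed
  then have "p holomorphic_on ?D"
    by (rule holomorphic_onI_DERIV[OF open_ball])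
  then obtain h where h: "\<And>z. z \<in> ?D \<Longrightarrow> (h has_field_derivative p z) (at z within ?D)"
    using holomorphic_convex_primitive'[OF convex_ball open_ball] by blast
  have h: "(h has_field_derivative p z) (at z)" if "z \<in> ?D" for z
    using h[OF that] unfolding at_within_open[OF that open_ball] .
  \<comment> \<open>Subtracting \<open>h\<close> leaves a derivative taking \<open>v\<close> to
    \<open>q z * cnj v\<close>; its conjugate is complex linear, so this function serves as
    \<open>g\<close> directly, without a primitive for \<open>q\<close>.\<close>
  have "((\<lambda>w. cnj (f w - h w)) has_field_derivative cnj (q z)) (at z)" if z: "z \<in> ?D" for z
  proof -
    let ?A = "\<lambda>v. cnj (f' z v - p z * v)"
    have d: "((\<lambda>w. cnj (f w - h w)) has_derivative ?A) (at z)"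
      using f'[OF z] h[OF z] unfolding has_field_derivative_def
      by (auto intro!: derivative_eq_intros has_derivative_cnj)
    have 1: "?A 1 = cnj (q z)"
      by (simp add: p_def q_def complex_eq_iff add_divide_distrib diff_divide_distrib)
    have "?A \<i> = \<i> * ?A 1" unfolding 1 by (simp add: p_def q_def complex_eq_iff add_divide_distrib diff_divide_distrib)
    from has_derivative_imp_has_field_derivative_complex[OF d this] show ?thesis unfolding 1 .
  qed
  then have "(\<lambda>w. cnj (f w - h w)) holomorphic_on ?D" by (rule holomorphic_onI_DERIV[OF open_ball])
  moreover have "h holomorphic_on ?D" using h by (rule holomorphic_onI_DERIV[OF open_ball])
  ultimately show ?thesis by (intro that[of h "\<lambda>w. cnj (f w - h w)"]) auto
qed

subsection \<open>Smoothness of holomorphic functions of several variables\<close>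

lemma C2_on_cong:
  assumes "open S" "\<And>x. x \<in> S \<Longrightarrow> f x = g x" "C2_on f S"
  shows "C2_on g S"
proof -
  from assms(3) obtain f' f'' where
    "\<And>x. x \<in> S \<Longrightarrow> (f has_derivative blinfun_apply (f' x)) (at x)"
    "\<And>x. x \<in> S \<Longrightarrow> (f' has_derivative blinfun_apply (f'' x)) (at x)" "continuous_on S f''"
    unfolding C2_on_def by blast
  then show ?thesis unfolding C2_on_def using assms(1,2)
    by (intro exI[of _ f'] exI[of _ f'']) (blast intro: has_derivative_transform_within_open)
qed

lemma C2_on_add:
  assumes "C2_on f S" "C2_on g S"
  shows "C2_on (\<lambda>x. f x + g x) S"
proof -
  from assms(1) obtain f' f'' where
    "\<And>x. x \<in> S \<Longrightarrow> (f has_derivative blinfun_apply (f' x)) (at x)"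
    "\<And>x. x \<in> S \<Longrightarrow> (f' has_derivative blinfun_apply (f'' x)) (at x)" "continuous_on S f''"
    unfolding C2_on_def by blast
  moreover from assms(2) obtain g' g'' where
    "\<And>x. x \<in> S \<Longrightarrow> (g has_derivative blinfun_apply (g' x)) (at x)"
    "\<And>x. x \<in> S \<Longrightarrow> (g' has_derivative blinfun_apply (g'' x)) (at x)" "continuous_on S g''"
    unfolding C2_on_def by blast
  ultimately show ?thesis unfolding C2_on_def
    by (intro exI[of _ "\<lambda>x. f' x + g' x"] exI[of _ "\<lambda>x. f'' x + g'' x"])
       (auto intro!: derivative_eq_intros continuous_intros simp: blinfun.add_left)
qed

text \<open>Conjugation is real linear, so it acts on first derivatives by left composition with
  \<open>C\<close>, and on second derivatives by left composition with \<open>D\<close>, the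
  operator that composes with \<open>C\<close>.\<close>

lemma C2_on_cnj:
  assumes "C2_on f S"
  shows "C2_on (\<lambda>x. cnj (f x)) S"
proof -
  from assms obtain f' f'' where f':
    "\<And>x. x \<in> S \<Longrightarrow> (f has_derivative blinfun_apply (f' x)) (at x)"
    and f'': "\<And>x. x \<in> S \<Longrightarrow> (f' has_derivative blinfun_apply (f'' x)) (at x)" and c: "continuous_on S f''"
    unfolding C2_on_def by blast
  define C where "C = Blinfun cnj"
  have C: "blinfun_apply C = cnj" by (simp add: C_def bounded_linear_Blinfun_apply bounded_linear_cnj)
  have bl: "bounded_linear ((o\<^sub>L) C :: ('a \<Rightarrow>\<^sub>L complex) \<Rightarrow> _)"
    by (rule bounded_bilinear.bounded_linear_right[OF bounded_bilinear_blinfun_compose])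
  define D where "D = Blinfun ((o\<^sub>L) C :: ('a \<Rightarrow>\<^sub>L complex) \<Rightarrow> _)"
  have D: "blinfun_apply D = (o\<^sub>L) C" by (simp add: D_def bounded_linear_Blinfun_apply bl)
  show ?thesis unfolding C2_on_def
  proof (intro exI[of _ "\<lambda>x. C o\<^sub>L f' x"] exI[of _ "\<lambda>x. D o\<^sub>L f'' x"] conjI ballI)
    fix x assume x: "x \<in> S"
    show "((\<lambda>x. cnj (f x)) has_derivative blinfun_apply (C o\<^sub>L f' x)) (at x)"
      by (rule has_derivative_eq_rhs[OF has_derivative_cnj[OF f'[OF x]]]) (simp add: C fun_eq_iff)
    show "((\<lambda>x. C o\<^sub>L f' x) has_derivative blinfun_apply (D o\<^sub>L f'' x)) (at x)"
      by (rule has_derivative_eq_rhs[OF bounded_linear.has_derivative[OF bl f''[OF x]]]) (simp add: D fun_eq_iff)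
  next
    show "continuous_on S (\<lambda>x. D o\<^sub>L f'' x)"
      by (intro continuous_intros c)
  qed
qed

lemma bounded_linear_mult_right_compose:
  "bounded_linear (\<lambda>c::complex. blinfun_mult_right c o\<^sub>L l)"
  by (intro bounded_linear_compose[OF bounded_bilinear.bounded_linear_left[OF bounded_bilinear_blinfun_compose]]
        bounded_linear_blinfun_mult_right)

text \<open>Reduces C2 regularity to C1 regularity of finitely many scalar coefficients
  \<open>p k\<close>: multiplying the fixed functional \<open>l k\<close> by a scalar is bounded
  linear in the scalar, which transports derivatives and continuity into the operator space. One
  variable uses a single identity functional, several variables use the coordinates.\<close>

lemma C2_onI_sum:
  fixes f :: "'a::real_normed_vector \<Rightarrow> complex" and l :: "'k \<Rightarrow> 'a \<Rightarrow>\<^sub>L complex"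
  assumes I: "finite I"
    and f: "\<And>x. x \<in> S \<Longrightarrow> (f has_derivative (\<lambda>v. \<Sum>k\<in>I. p k x * l k v)) (at x)"
    and p: "\<And>x k. x \<in> S \<Longrightarrow> k \<in> I \<Longrightarrow> (p k has_derivative blinfun_apply (p' k x)) (at x)"
    and c: "\<And>k. k \<in> I \<Longrightarrow> continuous_on S (p' k)"
  shows "C2_on f S"
proof -
  define T where "T = (\<lambda>k c. blinfun_mult_right c o\<^sub>L l k)"
  have bl: "bounded_linear (T k)" for k
    unfolding T_def by (rule bounded_linear_mult_right_compose)
  define TT where "TT = (\<lambda>k. Blinfun (T k))"
  have TT: "blinfun_apply (TT k) = T k" for k by (simp add: TT_def bounded_linear_Blinfun_apply bl)
  show ?thesis unfolding C2_on_def
  proof (intro exI[of _ "\<lambda>x. \<Sum>k\<in>I. T k (p k x)"] exI[of _ "\<lambda>x. \<Sum>k\<in>I. TT k o\<^sub>L p' k x"] conjI ballI)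
    fix x assume x: "x \<in> S"
    show "(f has_derivative blinfun_apply (\<Sum>k\<in>I. T k (p k x))) (at x)"
      by (rule has_derivative_eq_rhs[OF f[OF x]]) (simp add: fun_eq_iff T_def blinfun.sum_left)
    have "((\<lambda>x. \<Sum>k\<in>I. T k (p k x)) has_derivative (\<lambda>v. \<Sum>k\<in>I. T k (p' k x v))) (at x)"
      by (intro has_derivative_sum bounded_linear.has_derivative[OF bl] p x)
    then show "((\<lambda>x. \<Sum>k\<in>I. T k (p k x)) has_derivative blinfun_apply (\<Sum>k\<in>I. TT k o\<^sub>L p' k x)) (at x)"
      by (rule has_derivative_eq_rhs) (simp add: TT fun_eq_iff blinfun.sum_left)
  next
    show "continuous_on S (\<lambda>x. \<Sum>k\<in>I. TT k o\<^sub>L p' k x)"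
      by (intro continuous_intros c)
  qed
qed

lemma holomorphic_imp_C2_on:
  assumes f: "f holomorphic_on S" and S: "open S"
  shows "C2_on f S"
proof (rule C2_onI_sum[where I = "{()}" and l = "\<lambda>_. id_blinfun" and p = "\<lambda>_. deriv f"
      and p' = "\<lambda>_ x. blinfun_mult_right (deriv (deriv f) x)"])
  note h = holomorphic_deriv[OF f S]
  show "(f has_derivative (\<lambda>v. \<Sum>k\<in>{()}. deriv f x * id_blinfun v)) (at x)" if "x \<in> S" for x
    using holomorphic_derivI[OF f S that] by (simp add: has_field_derivative_def)
  show "(deriv f has_derivative blinfun_mult_right (deriv (deriv f) x)) (at x)" if "x \<in> S" for x
    using holomorphic_derivI[OF h S that] by (simp add: has_field_derivative_def)
  show "continuous_on S (\<lambda>x. blinfun_mult_right (deriv (deriv f) x))"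
    by (intro bounded_linear.continuous_on[OF bounded_linear_blinfun_mult_right]
          holomorphic_on_imp_continuous_on holomorphic_deriv h S)
qed simp

lemma harmonic_on_holomorphic_plus_cnj:
  assumes S: "open S" and h: "h holomorphic_on S" and g: "g holomorphic_on S"
    and f: "\<And>z. z \<in> S \<Longrightarrow> f z = h z + cnj (g z)"
  shows "harmonic_on f S"
  unfolding harmonic_on_def
proof (intro conjI ballI)
  have "C2_on (\<lambda>z. h z + cnj (g z)) S"
    by (intro C2_on_add C2_on_cnj holomorphic_imp_C2_on h g S)
  then show "C2_on f S" by (rule C2_on_cong[OF S, rotated]) (simp add: f)
next
  \<comment> \<open>The factors \<open>a\<close> and \<open>b\<close> let one formula serve twice:
    with value 1 for \<open>f\<close>, and with value \<open>v\<close> for its first directional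
    derivative, which has the same shape.\<close>
  have dd: "dir_deriv (\<lambda>z. h z * a + cnj (g z * b)) v z = deriv h z * v * a + cnj (deriv g z * v * b)"
    if "z \<in> S" "h holomorphic_on S" "g holomorphic_on S" for h g a b v z
    using holomorphic_derivI[OF that(2) S that(1)] holomorphic_derivI[OF that(3) S that(1)]
    by (intro dir_deriv_eq[where A = "\<lambda>v. deriv h z * v * a + cnj (deriv g z * v * b)"])
       (auto simp: has_field_derivative_def intro!: derivative_eq_intros has_derivative_cnj)
  fix z assume z: "z \<in> S"
  have 1: "dir_deriv f v w = deriv h w * v + cnj (deriv g w * v)" if w: "w \<in> S" for v w
    using dd[OF w h g, of 1 1 v] dir_deriv_cong[OF S w, of f "\<lambda>z. h z * 1 + cnj (g z * 1)" v] f
    by simp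
  have 2: "dir_deriv (dir_deriv f v) v z = deriv (deriv h) z * v * v + cnj (deriv (deriv g) z * v * v)" for v
    using dd[OF z holomorphic_deriv[OF h S] holomorphic_deriv[OF g S], of v v v]
      dir_deriv_cong[OF S z, of "dir_deriv f v" "\<lambda>w. deriv h w * v + cnj (deriv g w * v)" v] 1
    by simp
  show "laplacian f z = 0" unfolding laplacian_def 2 by (simp add: mult.assoc)
qed

section \<open>Complex slices and the regularity of partial derivatives\<close>

lemma norm_vector_smult:
  fixes v :: "complex ^ 'n"
  shows "norm (c *s v) = norm c * norm v"
  by (simp add: norm_vec_def norm_mult L2_set_right_distrib)

lemma bounded_linear_vector_smult_left: "bounded_linear (\<lambda>c::complex. c *s (v :: complex ^ 'n))"
  by (intro linear_conv_bounded_linear[THEN iffD1] linearI)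
     (simp_all add: vec_eq_iff algebra_simps)

lemma norm_axis_complex_1: "norm (axis k (1::complex)) = 1"
  by (simp add: norm_vec_def L2_set_def axis_def if_distrib[of norm] if_distrib[of "\<lambda>x. x\<^sup>2"] cong: if_cong)

lemma cn_holomorphic_slice_DERIV:
  fixes f :: "complex ^ 'n \<Rightarrow> complex"
  assumes f: "(f has_derivative A) (at (a + z *s b))" and lin: "\<And>c v. A (c *s v) = c * A v"
  shows "((\<lambda>z. f (a + z *s b)) has_field_derivative A b) (at z)"
proof -
  have "((\<lambda>z. a + z *s b) has_derivative (\<lambda>c. c *s b)) (at z)"
    by (auto intro!: derivative_eq_intros bounded_linear_imp_has_derivative bounded_linear_vector_smult_left)
  from has_derivative_compose[OF this f] show ?thesis
    unfolding has_field_derivative_def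
    by (rule has_derivative_eq_rhs) (simp add: fun_eq_iff lin mult.commute)
qed

lemma cn_holomorphic_slice:
  fixes f :: "complex ^ 'n \<Rightarrow> complex"
  assumes f: "cn_holomorphic_on f S" and T: "open T" "\<And>z. z \<in> T \<Longrightarrow> a + z *s b \<in> S"
  shows "(\<lambda>z. f (a + z *s b)) holomorphic_on T"
  unfolding holomorphic_on_open[OF T(1)]
  using f T(2) cn_holomorphic_slice_DERIV unfolding cn_holomorphic_on_def by metis

lemma cn_holomorphic_imp_continuous_on:
  "cn_holomorphic_on f S \<Longrightarrow> continuous_on S f"
  unfolding cn_holomorphic_on_def
  by (metis continuous_at_imp_continuous_on has_derivative_continuous)

text \<open>As a one-variable complex derivative along a slice, the partial derivative is accessible
  to Cauchy's integral formula.\<close>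

definition cn_partial :: "'n \<Rightarrow> (complex ^ 'n \<Rightarrow> complex) \<Rightarrow> complex ^ 'n \<Rightarrow> complex" where
  "cn_partial k f z = deriv (\<lambda>c. f (z + c *s axis k 1)) 0"

lemma cn_holomorphic_has_derivative_partial:
  fixes f :: "complex ^ 'n \<Rightarrow> complex"
  assumes f: "cn_holomorphic_on f S" and z: "z \<in> S"
  shows "(f has_derivative (\<lambda>v. \<Sum>k\<in>UNIV. cn_partial k f z * v $ k)) (at z)"
proof -
  from assms obtain A where A: "(f has_derivative A) (at z)" and lin: "\<And>c v. A (c *s v) = c * A v"
    unfolding cn_holomorphic_on_def by blast
  interpret bounded_linear A using A by (rule has_derivative_bounded_linear)
  have p: "cn_partial k f z = A (axis k 1)" for k
    using cn_holomorphic_slice_DERIV[of f A z 0 "axis k 1"] A lin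
    by (simp add: cn_partial_def DERIV_imp_deriv)
  have "A v = (\<Sum>k\<in>UNIV. cn_partial k f z * v $ k)" for v
  proof -
    have "A v = A (\<Sum>k\<in>UNIV. (v $ k) *s axis k 1)" by (simp add: basis_expansion)
    then show ?thesis by (simp add: sum lin p mult.commute)
  qed
  then have "A = (\<lambda>v. \<Sum>k\<in>UNIV. cn_partial k f z * v $ k)" by blast
  with A show ?thesis by simp
qed

text \<open>The velocity of the circle cancels the factor \<open>2 * pi * \<i>\<close> and one power
  in Cauchy's kernel. The result is an integral over a fixed compact interval, the form in which
  theorems on parameter integrals apply.\<close>

lemma Cauchy_deriv_integral:
  fixes r R :: real
  assumes f: "f holomorphic_on ball 0 R" and r: "0 < r" "r < R"
  shows "deriv f 0 = integral (cbox 0 1) (\<lambda>t. f (r * exp (2 * of_real pi * \<i> * of_real t)) / (r * exp (2 * of_real pi * \<i> * of_real t)))"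
proof -
  have "continuous_on (cball 0 r) f" "f holomorphic_on ball 0 r"
    using r by (auto intro!: holomorphic_on_imp_continuous_on holomorphic_on_subset[OF f])
  then have "deriv f 0 = 1 / (2 * of_real pi * \<i>) * contour_integral(circlepath 0 r) (\<lambda>u. f u / (u-0)^2)"
    using r by (intro DERIV_imp_deriv Cauchy_derivative_integral_circlepath) auto
  also have "contour_integral (circlepath 0 r) (\<lambda>u. f u / (u-0)^2) =
      integral {0..1} (\<lambda>t. (2 * of_real pi * \<i>) * (f (r * exp (2 * of_real pi * \<i> * of_real t)) / (r * exp (2 * of_real pi * \<i> * of_real t))))"
    unfolding contour_integral_integral vector_derivative_circlepath unfolding circlepath
    using r by (intro integral_cong) (simp add: power2_eq_square field_simps)
  finally show ?thesis unfolding integral_mult_right by simp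
qed

lemma cn_partial_eq_integral:
  fixes f :: "complex ^ 'n \<Rightarrow> complex" and r R :: real
  assumes f: "cn_holomorphic_on f S" and S: "ball z R \<subseteq> S" and r: "0 < r" "r < R"
  shows "cn_partial k f z = integral (cbox 0 1) (\<lambda>t. f (z + (r * exp (2 * of_real pi * \<i> * of_real t)) *s axis k 1) / (r * exp (2 * of_real pi * \<i> * of_real t)))"
proof -
  have "norm (axis k (1::complex)) = 1" by (rule norm_axis_complex_1)
  then have "(\<lambda>c. f (z + c *s axis k 1)) holomorphic_on ball 0 R"
    by (intro cn_holomorphic_slice[OF f] subsetD[OF S]) (auto simp: dist_norm norm_vector_smult)
  from Cauchy_deriv_integral[OF this r] show ?thesis by (simp add: cn_partial_def)
qed

lemma cn_partial_continuous_on: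
  fixes f :: "complex ^ 'n \<Rightarrow> complex"
  assumes f: "cn_holomorphic_on f S" and S: "open S"
  shows "continuous_on S (cn_partial k f)"
proof (rule continuous_at_imp_continuous_on, rule ballI)
  fix x assume x: "x \<in> S"
  then obtain R where R: "R > 0" "ball x R \<subseteq> S" using S open_contains_ball by blast
  \<comment> \<open>With a third of the radius, the circles of radius \<open>r\<close> about every
    \<open>z\<close> in \<open>ball x r\<close> stay in \<open>S\<close>, so one integral formula
    represents the partial derivative on a whole neighbourhood of \<open>x\<close>.\<close>
  define r where "r = R / 3"
  define e where "e = (\<lambda>t. r * exp (2 * of_real pi * \<i> * of_real t))"
  have r: "0 < r" and ne: "norm (e t) = r" and e0: "e t \<noteq> 0" for t
    using R by (auto simp: r_def e_def norm_mult)
  have sub: "ball z (2 * r) \<subseteq> S" if "z \<in> ball x r" for z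
  proof
    fix y assume "y \<in> ball z (2 * r)"
    then have "dist x y < R" using that dist_triangle[of x y z] by (simp add: r_def)
    then show "y \<in> S" using R by auto
  qed
  have inS: "z + e t *s axis k 1 \<in> S" if "z \<in> ball x r" for z t
    using r by (intro subsetD[OF sub[OF that]]) (simp add: dist_norm norm_vector_smult norm_axis_complex_1 ne)
  have ce: "continuous_on X e" for X unfolding e_def by (intro continuous_intros)
  have c: "continuous_on (ball x r) (\<lambda>z. integral (cbox 0 1) (\<lambda>t. f (z + e t *s axis k 1) / e t))"
  proof (rule integral_continuous_on_param)
    have c: "continuous_on (ball x r \<times> cbox 0 1) (\<lambda>p. e (snd p))"
      by (rule continuous_on_compose2[OF ce[of UNIV]]) (auto intro!: continuous_intros)
    have "continuous_on (ball x r \<times> cbox 0 1) (\<lambda>p. f (fst p + e (snd p) *s axis k 1) / e (snd p))"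
      by (intro continuous_intros c continuous_on_compose2[OF cn_holomorphic_imp_continuous_on[OF f]]
           bounded_linear.continuous_on[OF bounded_linear_vector_smult_left])
         (use inS e0 in auto)
    then show "continuous_on (ball x r \<times> cbox 0 1) (\<lambda>(z, t). f (z + e t *s axis k 1) / e t)"
      by (simp add: case_prod_unfold)
  qed
  have eq: "cn_partial k f z = integral (cbox 0 1) (\<lambda>t. f (z + e t *s axis k 1) / e t)" if "z \<in> ball x r" for z
    unfolding e_def by (rule cn_partial_eq_integral[OF f sub[OF that]]) (use r in auto)
  have "continuous_on (ball x r) (cn_partial k f)"
    by (rule continuous_on_eq[OF c eq[symmetric]])
  then show "isCont (cn_partial k f) x"
    using r by (simp add: continuous_on_eq_continuous_at)
qed

text \<open>The derivative as an element of the operator space, so that its continuity can be stated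
  in the operator norm.\<close>

definition cn_total :: "(complex ^ 'n \<Rightarrow> complex) \<Rightarrow> complex ^ 'n \<Rightarrow> (complex ^ 'n) \<Rightarrow>\<^sub>L complex" where
  "cn_total f z = (\<Sum>k\<in>UNIV. blinfun_mult_right (cn_partial k f z) o\<^sub>L Blinfun (\<lambda>v. v $ k))"

lemma Blinfun_vec_nth [simp]: "blinfun_apply (Blinfun (\<lambda>v. v $ k)) = (\<lambda>v::complex^'n. v $ k)"
  by (simp add: bounded_linear_Blinfun_apply bounded_linear_vec_nth)

lemma cn_total_has_derivative:
  assumes "cn_holomorphic_on f S" "z \<in> S"
  shows "(f has_derivative blinfun_apply (cn_total f z)) (at z)"
  by (rule has_derivative_eq_rhs[OF cn_holomorphic_has_derivative_partial[OF assms]])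
     (simp add: cn_total_def fun_eq_iff blinfun.sum_left)

lemma cn_total_continuous_on:
  assumes "cn_holomorphic_on f S" "open S"
  shows "continuous_on S (cn_total f)"
  unfolding cn_total_def
  by (intro continuous_intros bounded_linear.continuous_on[OF bounded_linear_mult_right_compose]
      cn_partial_continuous_on[OF assms])

text \<open>The Cauchy integral is differentiated under the integral sign. The Leibniz rule asks for
  a jointly continuous derivative of the integrand, which is why continuity of the partial
  derivatives, hence of \<open>cn_total f\<close>, comes first. The statement is local because the
  radius of the circles depends on \<open>x\<close>.\<close>

lemma cn_partial_has_derivative_local:
  fixes f :: "complex ^ 'n \<Rightarrow> complex"
  assumes f: "cn_holomorphic_on f S" and S: "open S" and x: "x \<in> S"
  obtains r D where "r > 0" "continuous_on (ball x r) D"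
    "\<And>z. z \<in> ball x r \<Longrightarrow> (cn_partial k f has_derivative blinfun_apply (D z)) (at z)"
proof -
  obtain R where R: "R > 0" "ball x R \<subseteq> S" using S x open_contains_ball by blast
  define r where "r = R / 3"
  define e where "e = (\<lambda>t. r * exp (2 * of_real pi * \<i> * of_real t))"
  have r: "0 < r" and ne: "norm (e t) = r" and e0: "e t \<noteq> 0" for t
    using R by (auto simp: r_def e_def norm_mult)
  have sub: "ball z (2 * r) \<subseteq> S" if "z \<in> ball x r" for z
  proof
    fix y assume "y \<in> ball z (2 * r)"
    then have "dist x y < R" using that dist_triangle[of x y z] by (simp add: r_def)
    then show "y \<in> S" using R by auto
  qed
  have inS: "z + e t *s axis k 1 \<in> S" if "z \<in> ball x r" for z t
    using r by (intro subsetD[OF sub[OF that]]) (simp add: dist_norm norm_vector_smult norm_axis_complex_1 ne)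
  have ce: "continuous_on X e" for X unfolding e_def by (intro continuous_intros)
  define fx where "fx = (\<lambda>z t. blinfun_mult_right (1 / e t) o\<^sub>L cn_total f (z + e t *s axis k 1))"
  define D where "D = (\<lambda>z. integral (cbox 0 1) (fx z))"
  have c: "continuous_on (ball x r \<times> cbox 0 1) (\<lambda>p. e (snd p))"
    by (rule continuous_on_compose2[OF ce[of UNIV]]) (auto intro!: continuous_intros)
  have cfx: "continuous_on (ball x r \<times> cbox 0 1) (\<lambda>(z, t). fx z t)"
    unfolding fx_def case_prod_unfold
    by (intro continuous_intros c continuous_on_compose2[OF cn_total_continuous_on[OF f S]]
           bounded_linear.continuous_on[OF bounded_linear_vector_smult_left]
           bounded_linear.continuous_on[OF bounded_linear_blinfun_mult_right])
         (use inS e0 in auto)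
  have eq: "cn_partial k f z = integral (cbox 0 1) (\<lambda>t. f (z + e t *s axis k 1) / e t)" if "z \<in> ball x r" for z
    unfolding e_def by (rule cn_partial_eq_integral[OF f sub[OF that]]) (use r in auto)
  have "(cn_partial k f has_derivative blinfun_apply (D z)) (at z)" if z: "z \<in> ball x r" for z
  proof -
    have "((\<lambda>z. integral (cbox 0 1) (\<lambda>t. f (z + e t *s axis k 1) / e t)) has_derivative blinfun_apply (D z)) (at z within ball x r)"
      unfolding D_def
    proof (rule leibniz_rule[OF _ _ cfx z convex_ball])
      fix y t assume y: "y \<in> ball x r"
      have "((\<lambda>z. z + e t *s axis k 1) has_derivative (\<lambda>v. v)) (at y within ball x r)"
        by (auto intro!: derivative_eq_intros)
      note has_derivative_compose[OF this cn_total_has_derivative[OF f inS[OF y]]]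
      from has_derivative_mult_right[OF this, of "1 / e t"]
      show "((\<lambda>z. f (z + e t *s axis k 1) / e t) has_derivative blinfun_apply (fx y t)) (at y within ball x r)"
        by (simp add: fx_def o_def blinfun_compose.rep_eq)
    next
      fix y assume y: "y \<in> ball x r"
      show "(\<lambda>t. f (y + e t *s axis k 1) / e t) integrable_on cbox 0 1"
        by (intro integrable_continuous continuous_intros ce continuous_on_compose2[OF cn_holomorphic_imp_continuous_on[OF f]]
           bounded_linear.continuous_on[OF bounded_linear_vector_smult_left])
         (use inS[OF y] e0 in auto)
    qed
    then show ?thesis unfolding at_within_open[OF z open_ball]
      by (rule has_derivative_transform_within_open[OF _ open_ball z]) (simp add: eq)
  qed
  moreover have "continuous_on (ball x r) D"
    unfolding D_def by (rule integral_continuous_on_param[OF cfx])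
  ultimately show ?thesis using r that by blast
qed

lemma cn_holomorphic_imp_C2_on:
  fixes f :: "complex ^ 'n \<Rightarrow> complex"
  assumes f: "cn_holomorphic_on f S" and S: "open S"
  shows "C2_on f S"
proof -
  have "\<exists>D. continuous_on S D \<and> (\<forall>z\<in>S. (cn_partial k f has_derivative blinfun_apply (D z)) (at z))" for k
  proof -
    have "\<exists>D. (cn_partial k f has_derivative blinfun_apply D) (at z)" if "z \<in> S" for z
      using cn_partial_has_derivative_local[OF f S that, of k] by (metis centre_in_ball)
    then obtain D where D: "\<And>z. z \<in> S \<Longrightarrow> (cn_partial k f has_derivative blinfun_apply (D z)) (at z)"
      by metis
    \<comment> \<open>\<open>D\<close> was chosen point by point; near \<open>x\<close> it agrees
      with the continuous local derivative \<open>E\<close> because Frechet derivatives are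
      unique.\<close>
    have "isCont D x" if x: "x \<in> S" for x
    proof -
      obtain r E where r: "r > 0" and E: "continuous_on (ball x r) E"
        "\<And>z. z \<in> ball x r \<Longrightarrow> (cn_partial k f has_derivative blinfun_apply (E z)) (at z)"
        using cn_partial_has_derivative_local[OF f S x] by blast
      have *: "D z = E z" if "z \<in> ball x r \<inter> S" for z
        using has_derivative_unique[OF D E(2)] that by (auto intro!: blinfun_eqI)
      have "continuous_on (ball x r \<inter> S) E" using E(1) by (rule continuous_on_subset) auto
      then have "continuous_on (ball x r \<inter> S) D" by (rule continuous_on_eq) (simp add: *)
      then show ?thesis using r x S by (simp add: continuous_on_eq_continuous_at open_Int)
    qed
    then show ?thesis using D by (auto intro: continuous_at_imp_continuous_on)
  qed
  then obtain D where D: "\<And>k. continuous_on S (D k)"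
    "\<And>k z. z \<in> S \<Longrightarrow> (cn_partial k f has_derivative blinfun_apply (D k z)) (at z)"
    by metis
  show ?thesis
    by (rule C2_onI_sum[where I = UNIV and p = "\<lambda>k. cn_partial k f" and p' = D and l = "\<lambda>k. Blinfun (\<lambda>v. v $ k)"])
       (use D cn_holomorphic_has_derivative_partial[OF f] in simp_all)
qed

lemma pluriharmonic_on_cn_holomorphic_plus_cnj:
  fixes f :: "complex ^ 'n \<Rightarrow> complex"
  assumes S: "open S" and h: "cn_holomorphic_on h S" and g: "cn_holomorphic_on g S"
    and f: "\<And>z. z \<in> S \<Longrightarrow> f z = h z + cnj (g z)"
  shows "pluriharmonic_on f S"
  unfolding pluriharmonic_on_def
proof (intro conjI allI impI)
  have "C2_on (\<lambda>z. h z + cnj (g z)) S"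
    by (intro C2_on_add C2_on_cnj cn_holomorphic_imp_C2_on h g S)
  then show "C2_on f S" by (rule C2_on_cong[OF S, rotated]) (simp add: f)
next
  fix a b :: "complex ^ 'n"
  have o: "open {z. a + z *s b \<in> S}"
    using open_vimage[OF S, of "\<lambda>z. a + z *s b"]
    by (simp add: vimage_def continuous_on_add bounded_linear.continuous_on[OF bounded_linear_vector_smult_left])
  show "harmonic_on (\<lambda>z. f (a + z *s b)) {z. a + z *s b \<in> S}"
    by (rule harmonic_on_holomorphic_plus_cnj[OF o cn_holomorphic_slice[OF h o] cn_holomorphic_slice[OF g o]])
       (auto simp: f)
qed

lemma cn_holomorphic_compose:
  fixes f :: "complex ^ 'n \<Rightarrow> complex"
  assumes f: "cn_holomorphic_on f S" and g: "g holomorphic_on T" "open T" "f ` S \<subseteq> T"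
  shows "cn_holomorphic_on (g \<circ> f) S"
  unfolding cn_holomorphic_on_def
proof
  fix z assume z: "z \<in> S"
  with f obtain A where A: "(f has_derivative A) (at z)" and lin: "\<And>c v. A (c *s v) = c * A v"
    unfolding cn_holomorphic_on_def by blast
  have "(g has_derivative (*) (deriv g (f z))) (at (f z))"
    using holomorphic_derivI[OF g(1,2), of "f z"] g(3) z by (auto simp: has_field_derivative_def)
  from has_derivative_compose[OF A this]
  show "\<exists>A. (g \<circ> f has_derivative A) (at z) \<and> (\<forall>c v. A (c *s v) = c * A v)"
    by (intro exI[of _ "\<lambda>v. deriv g (f z) * A v"]) (simp add: o_def lin)
qed

subsection \<open>Growth of derivatives and Lipschitz conditions\<close>

text \<open>Cauchy's inequality is used on the circle of radius \<open>r / 2\<close>, since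
  \<open>f\<close> is controlled only on the open ball; this costs the factor 2.\<close>

lemma norm_deriv_le_of_bounded:
  fixes f :: "complex \<Rightarrow> complex"
  assumes f: "f holomorphic_on ball w r" and r: "r > 0"
    and B: "\<And>z. z \<in> ball w r \<Longrightarrow> norm (f z) \<le> B"
  shows "norm (deriv f w) \<le> 2 * B / r"
proof -
  have sub: "cball w (r/2) \<subseteq> ball w r" using r by auto
  have "norm ((deriv ^^ 1) f w) \<le> fact 1 * B / (r/2)^1"
  proof (rule Cauchy_inequality)
    show "f holomorphic_on ball w (r/2)" using f sub by (meson ball_subset_cball holomorphic_on_subset subset_trans)
    show "continuous_on (cball w (r/2)) f"
      by (rule holomorphic_on_imp_continuous_on[OF holomorphic_on_subset[OF f sub]])
    show "norm (f x) \<le> B" if "norm (w - x) = r/2" for x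
      using that r by (intro B) (simp add: dist_norm)
  qed (use r in simp)
  then show ?thesis by (simp add: mult.commute)
qed

text \<open>If \<open>\<bar>Re a\<bar> \<le> K\<close> then \<open>\<bar>a\<bar> \<le> \<bar>2 * K - a\<bar>\<close>, so with \<open>a = F z - F w\<close> the function
  \<open>a / (2 * K - a)\<close> is bounded by 1 and Cauchy's inequality applies to it.\<close>

lemma norm_deriv_le_of_Re_bounded:
  fixes F :: "complex \<Rightarrow> complex"
  assumes F: "F holomorphic_on ball w r" and r: "r > 0"
    and M: "\<And>z. z \<in> ball w r \<Longrightarrow> \<bar>Re (F z - F w)\<bar> \<le> M"
  shows "norm (deriv F w) \<le> 4 * M / r"
proof -
  \<comment> \<open>A strictly positive \<open>K\<close> keeps the denominator away from 0 even if
    \<open>M = 0\<close>; the bound for \<open>M\<close> follows by letting \<open>K\<close>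
    decrease to \<open>M\<close>.\<close>
  have pos: "norm (deriv F w) \<le> 4 * K / r" if K: "K > 0" "M \<le> K" for K
  proof -
    define G where "G = (\<lambda>z. (F z - F w) / (2 * K - (F z - F w)))"
    have R: "Re (F z - F w) \<le> K" if "z \<in> ball w r" for z
      using M[OF that] K by linarith
    have ne: "2 * K - (F z - F w) \<noteq> 0" if "z \<in> ball w r" for z
    proof
      assume "2 * K - (F z - F w) = 0"
      then have "Re (2 * K - (F z - F w)) = 0" by simp
      then show False using R[OF that] K by simp
    qed
    have w: "w \<in> ball w r" using r by simp
    have "norm (G z) \<le> 1" if z: "z \<in> ball w r" for z
    proof -
      define a where "a = F z - F w"
      have "K * Re a \<le> K * K" using R[OF z] K by (intro mult_left_mono) (auto simp: a_def)
      then have "(norm a)^2 \<le> (norm (2 * K - a))^2"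
        unfolding cmod_power2 by (simp add: power2_eq_square algebra_simps)
      then have "norm a \<le> norm (2 * K - a)" by (rule power2_le_imp_le) simp
      then show ?thesis using ne[OF z] by (simp add: G_def norm_divide a_def[symmetric] divide_le_eq_1)
    qed
    moreover have "G holomorphic_on ball w r"
      unfolding G_def using ne by (intro holomorphic_intros F) auto
    ultimately have "norm (deriv G w) \<le> 2 * 1 / r" using r by (intro norm_deriv_le_of_bounded) auto
    moreover have "(G has_field_derivative (deriv F w / (2 * K))) (at w)"
      unfolding G_def using holomorphic_derivI[OF F open_ball w] K
      by (auto intro!: derivative_eq_intros simp: field_simps power2_eq_square)
    then have "deriv G w = deriv F w / (2 * K)" by (rule DERIV_imp_deriv)
    ultimately show ?thesis using K r by (simp add: norm_divide norm_mult divide_simps mult_ac)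
  qed
  have M0: "M \<ge> 0" using M[of w] r by simp
  show ?thesis
  proof (rule field_le_epsilon)
    fix e :: real assume e: "e > 0"
    have "norm (deriv F w) \<le> 4 * (M + e * r / 4) / r"
      using e r M0 by (intro pos) (auto intro!: add_nonneg_pos)
    also have "\<dots> = 4 * M / r + e" using r by (simp add: field_simps)
    finally show "norm (deriv F w) \<le> 4 * M / r + e" .
  qed
qed

text \<open>\<open>h + g\<close> has the real part of \<open>f\<close>, and the real part of
  \<open>\<i> * (h - g)\<close> is minus the imaginary part of \<open>f\<close>. So the oscillation
  of \<open>f\<close> bounds \<open>h' + g'\<close> and \<open>h' - g'\<close> by
  \<open>4 * M / r\<close> each, and then \<open>h'\<close> and \<open>g'\<close>
  separately.\<close>

lemma holomorphic_plus_cnj_deriv_bound: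
  assumes h: "h holomorphic_on ball w r" and g: "g holomorphic_on ball w r" and r: "r > 0"
    and f: "\<And>z. z \<in> ball w r \<Longrightarrow> f z = h z + cnj (g z)"
    and M: "\<And>z. z \<in> ball w r \<Longrightarrow> norm (f z - f w) \<le> M"
  shows "norm (deriv h w) + norm (deriv g w) \<le> 8 * M / r"
proof -
  have w: "w \<in> ball w r" using r by simp
  note D = holomorphic_derivI[OF h open_ball w] holomorphic_derivI[OF g open_ball w]
  have 1: "norm (deriv (\<lambda>z. h z + g z) w) \<le> 4 * M / r"
  proof (rule norm_deriv_le_of_Re_bounded[OF _ r])
    fix z assume z: "z \<in> ball w r"
    have "Re (h z + g z - (h w + g w)) = Re (f z - f w)" by (simp add: f[OF z] f[OF w])
    then show "\<bar>Re (h z + g z - (h w + g w))\<bar> \<le> M"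
      using M[OF z] abs_Re_le_cmod[of "f z - f w"] by linarith
  qed (intro holomorphic_intros h g)
  have 2: "norm (deriv (\<lambda>z. \<i> * (h z - g z)) w) \<le> 4 * M / r"
  proof (rule norm_deriv_le_of_Re_bounded[OF _ r])
    fix z assume z: "z \<in> ball w r"
    have "Re (\<i> * (h z - g z) - \<i> * (h w - g w)) = - Im (f z - f w)" by (simp add: f[OF z] f[OF w])
    then show "\<bar>Re (\<i> * (h z - g z) - \<i> * (h w - g w))\<bar> \<le> M"
      using M[OF z] abs_Im_le_cmod[of "f z - f w"] by linarith
  qed (intro holomorphic_intros h g)
  have "deriv (\<lambda>z. h z + g z) w = deriv h w + deriv g w"
    by (rule DERIV_imp_deriv) (auto intro!: derivative_eq_intros D)
  then have 3: "norm (deriv h w + deriv g w) \<le> 4 * M / r" using 1 by simp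
  have "deriv (\<lambda>z. \<i> * (h z - g z)) w = \<i> * (deriv h w - deriv g w)"
    by (rule DERIV_imp_deriv) (auto intro!: derivative_eq_intros D)
  then have 4: "norm (deriv h w - deriv g w) \<le> 4 * M / r" using 2 by (simp add: norm_mult)
  have "2 * norm (deriv h w) = norm ((deriv h w + deriv g w) + (deriv h w - deriv g w))"
    by (simp flip: mult_2 add: norm_mult)
  also have "\<dots> \<le> 2 * (4 * M / r)" using norm_triangle_ineq[of "deriv h w + deriv g w" "deriv h w - deriv g w"] 3 4 by linarith
  finally have 5: "norm (deriv h w) \<le> 4 * M / r" by simp
  have "2 * norm (deriv g w) = norm ((deriv h w + deriv g w) - (deriv h w - deriv g w))"
    by (simp flip: mult_2 add: norm_mult)
  also have "\<dots> \<le> 2 * (4 * M / r)" using norm_triangle_ineq4[of "deriv h w + deriv g w" "deriv h w - deriv g w"] 3 4 by linarith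
  finally have "norm (deriv g w) \<le> 4 * M / r" by simp
  with 5 show ?thesis by simp
qed

text \<open>Uses the largest disc about \<open>w\<close> inside the unit disc, of radius
  \<open>r = 1 - norm w\<close>, on which \<open>f\<close> differs from \<open>f w\<close> by at
  most \<open>S * r powr \<alpha>\<close>; dividing by \<open>r\<close> lowers the exponent by
  1.\<close>

lemma lipschitz_deriv_bound:
  assumes h: "h holomorphic_on ball 0 1" and g: "g holomorphic_on ball 0 1"
    and f: "\<And>z. z \<in> ball 0 1 \<Longrightarrow> f z = h z + cnj (g z)"
    and S: "\<And>z w. z \<in> ball 0 1 \<Longrightarrow> w \<in> ball 0 1 \<Longrightarrow> norm (f z - f w) \<le> S * norm (z - w) powr \<alpha>"
    and S0: "S \<ge> 0" and \<alpha>: "\<alpha> \<ge> 0" and w: "w \<in> ball (0::complex) 1"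
  shows "norm (deriv h w) + norm (deriv g w) \<le> 8 * S * (1 - norm w) powr (\<alpha> - 1)"
proof -
  define r where "r = 1 - norm w"
  have r: "r > 0" using w by (simp add: r_def)
  have sub: "ball w r \<subseteq> ball 0 1"
  proof
    fix z assume "z \<in> ball w r"
    then show "z \<in> ball 0 1" using dist_triangle[of 0 z w] by (simp add: r_def)
  qed
  have "norm (deriv h w) + norm (deriv g w) \<le> 8 * (S * r powr \<alpha>) / r"
  proof (rule holomorphic_plus_cnj_deriv_bound[OF _ _ r])
    show "h holomorphic_on ball w r" "g holomorphic_on ball w r"
      using h g sub by (auto intro: holomorphic_on_subset)
    fix z assume z: "z \<in> ball w r"
    then show "f z = h z + cnj (g z)" using f sub by blast
    have "norm (f z - f w) \<le> S * norm (z - w) powr \<alpha>" using S z w sub by blast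
    also have "\<dots> \<le> S * r powr \<alpha>"
      using z S0 \<alpha> by (intro mult_left_mono powr_mono2) (auto simp: dist_norm norm_minus_commute)
    finally show "norm (f z - f w) \<le> S * r powr \<alpha>" .
  qed
  also have "\<dots> = 8 * S * r powr (\<alpha> - 1)" using r by (simp add: powr_diff)
  finally show ?thesis unfolding r_def .
qed

text \<open>The weight is integrable up to the boundary because \<beta> is positive:
  \<open>\<psi>\<close> is a primitive of \<open>M * (1 - t) powr (\<beta> - 1)\<close> that grows
  by \<open>M * \<delta> powr \<beta> / \<beta>\<close> on \<open>{1 - \<delta>..1}\<close>. Along
  the ray the point at parameter \<open>t\<close> has norm at most \<open>t\<close>, and the
  exponent is not positive, so the weight there is at most its value in \<open>t\<close>. At
  \<open>t = 1\<close>, where \<open>\<psi>\<close> may fail to be differentiable, the comparison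
  asks only for continuity.\<close>

lemma radial_growth_bound:
  fixes u :: "'a::real_normed_vector \<Rightarrow> complex"
  assumes u: "\<And>z. z \<in> ball 0 1 \<Longrightarrow> (u has_derivative A z) (at z)"
    and bd: "\<And>z v. z \<in> ball 0 1 \<Longrightarrow> norm (A z v) \<le> M * (1 - norm z) powr (\<beta> - 1) * norm v"
    and M: "M \<ge> 0" and \<beta>: "0 < \<beta>" "\<beta> \<le> 1" and \<delta>: "0 < \<delta>" "\<delta> \<le> 1" and z: "z \<in> ball 0 1"
  shows "norm (u z - u ((1 - \<delta>) *\<^sub>R z)) \<le> M * \<delta> powr \<beta> / \<beta>"
proof -
  define \<psi> where "\<psi> = (\<lambda>t. - M * (1 - t) powr \<beta> / \<beta>)"
  have z1: "norm z < 1" using z by simp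
  have le: "t * norm z \<le> t" "t * norm z < 1" if "0 \<le> t" "t \<le> 1" for t
    using that z1 mult_left_mono[of "norm z" 1 t] mult_right_mono[of t 1 "norm z"] by auto
  have inb: "t *\<^sub>R z \<in> ball 0 1" if "0 \<le> t" "t \<le> 1" for t
    using le[OF that] that by simp
  have der: "((\<lambda>t. u (t *\<^sub>R z)) has_vector_derivative A (t *\<^sub>R z) z) (at t)" if t: "0 \<le> t" "t \<le> 1" for t
  proof -
    interpret bounded_linear "A (t *\<^sub>R z)" by (rule has_derivative_bounded_linear[OF u[OF inb[OF t]]])
    show ?thesis unfolding has_vector_derivative_def
      by (rule has_derivative_eq_rhs[OF has_derivative_compose[where f="\<lambda>t. t *\<^sub>R z" and g=u, OF _ u[OF inb[OF t]]]])
         (auto intro!: derivative_eq_intros simp: scaleR)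
  qed
  have "norm (u (1 *\<^sub>R z) - u ((1 - \<delta>) *\<^sub>R z)) \<le> \<psi> 1 - \<psi> (1 - \<delta>)"
  proof (rule differentiable_bound_general[where f' = "\<lambda>t. A (t *\<^sub>R z) z" and \<phi>' = "\<lambda>t. M * (1 - t) powr (\<beta> - 1)"])
    show "1 - \<delta> < 1" using \<delta> by simp
    show "continuous_on {1 - \<delta>..1} (\<lambda>t. u (t *\<^sub>R z))"
    proof (rule continuous_at_imp_continuous_on, rule ballI)
      fix t assume "t \<in> {1 - \<delta>..1}"
      then show "isCont (\<lambda>t. u (t *\<^sub>R z)) t"
        using \<delta> by (intro has_vector_derivative_continuous[OF der]) auto
    qed
    show "continuous_on {1 - \<delta>..1} \<psi>" unfolding \<psi>_def
      using \<beta> by (intro continuous_intros continuous_on_powr') auto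
    fix t assume t: "1 - \<delta> < t" "t < 1"
    then have t': "0 \<le> t" "t \<le> 1" using \<delta> by auto
    show "((\<lambda>t. u (t *\<^sub>R z)) has_vector_derivative A (t *\<^sub>R z) z) (at t)" by (rule der[OF t'])
    show "(\<psi> has_vector_derivative M * (1 - t) powr (\<beta> - 1)) (at t)"
      unfolding \<psi>_def has_real_derivative_iff_has_vector_derivative[symmetric]
      using t \<beta> by (auto intro!: derivative_eq_intros simp: powr_diff field_simps)
    have "norm (A (t *\<^sub>R z) z) \<le> M * (1 - norm (t *\<^sub>R z)) powr (\<beta> - 1) * norm z" by (rule bd[OF inb[OF t']])
    also have "\<dots> \<le> M * (1 - norm (t *\<^sub>R z)) powr (\<beta> - 1) * 1"
      using M z1 by (intro mult_left_mono) auto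
    also have "(1 - norm (t *\<^sub>R z)) powr (\<beta> - 1) \<le> (1 - t) powr (\<beta> - 1)"
      using t t' le[OF t'] \<beta> by (intro powr_mono2') auto
    finally show "norm (A (t *\<^sub>R z) z) \<le> M * (1 - t) powr (\<beta> - 1)" using M by (simp add: mult_left_mono)
  qed
  then show ?thesis using \<beta> by (simp add: \<psi>_def)
qed

text \<open>The points \<open>z\<close> and \<open>w\<close> are first moved radially to \<open>(1 - \<delta>) z\<close> and \<open>(1 - \<delta>) w\<close>, where
  \<open>\<delta> = min 1 \<bar>z - w\<bar>\<close>; the segment between these stays in the ball of radius \<open>1 - \<delta>\<close>.\<close>

lemma hardy_littlewood_lipschitz:
  fixes u :: "'a::real_normed_vector \<Rightarrow> complex"
  assumes u: "\<And>z. z \<in> ball 0 1 \<Longrightarrow> (u has_derivative A z) (at z)"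
    and bd: "\<And>z v. z \<in> ball 0 1 \<Longrightarrow> norm (A z v) \<le> M * (1 - norm z) powr (\<beta> - 1) * norm v"
    and M: "M \<ge> 0" and \<beta>: "0 < \<beta>" "\<beta> \<le> 1" and z: "z \<in> ball 0 1" and w: "w \<in> ball 0 1"
  shows "norm (u z - u w) \<le> M * (1 + 2 / \<beta>) * norm (z - w) powr \<beta>"
proof (cases "z = w")
  case False
  define \<delta> where "\<delta> = min 1 (norm (z - w))"
  have \<delta>: "0 < \<delta>" "\<delta> \<le> 1" and \<delta>2: "\<delta> \<le> norm (z - w)" using False by (auto simp: \<delta>_def)
  define z' where "z' = (1 - \<delta>) *\<^sub>R z"
  define w' where "w' = (1 - \<delta>) *\<^sub>R w"
  have 1: "norm (u z - u z') \<le> M * \<delta> powr \<beta> / \<beta>" and 2: "norm (u w - u w') \<le> M * \<delta> powr \<beta> / \<beta>"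
    unfolding z'_def w'_def using radial_growth_bound[OF u bd M \<beta> \<delta>] z w by blast+
  have 3: "norm (u z' - u w') \<le> M * \<delta> powr \<beta>"
  proof (cases "\<delta> = 1")
    case True
    then show ?thesis using M by (simp add: z'_def w'_def)
  next
    case False
    then have \<delta>3: "\<delta> < 1" "\<delta> = norm (z - w)" using \<delta> by (auto simp: \<delta>_def min_def split: if_splits)
    have sub: "x \<in> ball 0 1" if "x \<in> cball 0 (1 - \<delta>)" for x :: 'a using that \<delta> by simp
    have "norm (u z' - u w') \<le> (M * \<delta> powr (\<beta> - 1)) * norm (z' - w')"
    proof (rule differentiable_bound[OF convex_cball[of 0 "1 - \<delta>"]])
      show "(u has_derivative A x) (at x within cball 0 (1 - \<delta>))" if "x \<in> cball 0 (1 - \<delta>)" for x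
        by (rule has_derivative_at_withinI[OF u[OF sub[OF that]]])
      show "onorm (A x) \<le> M * \<delta> powr (\<beta> - 1)" if x: "x \<in> cball 0 (1 - \<delta>)" for x
      proof (rule onorm_bound)
        show "0 \<le> M * \<delta> powr (\<beta> - 1)" using M by simp
        fix v
        have "norm (A x v) \<le> M * (1 - norm x) powr (\<beta> - 1) * norm v" by (rule bd[OF sub[OF x]])
        also have "\<dots> \<le> M * \<delta> powr (\<beta> - 1) * norm v"
          using M x \<beta> \<delta> by (intro mult_right_mono mult_left_mono powr_mono2') auto
        finally show "norm (A x v) \<le> M * \<delta> powr (\<beta> - 1) * norm v" .
      qed
      show "z' \<in> cball 0 (1 - \<delta>)" "w' \<in> cball 0 (1 - \<delta>)"
        using z w \<delta>3 by (auto simp: z'_def w'_def mult_left_le)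
    qed
    also have "norm (z' - w') \<le> \<delta>"
    proof -
      have "norm (z' - w') = (1 - \<delta>) * norm (z - w)" using \<delta>3 by (simp add: z'_def w'_def flip: scaleR_diff_right)
      also have "\<dots> \<le> 1 * norm (z - w)" using \<delta> by (intro mult_right_mono) auto
      finally show ?thesis using \<delta>3 by simp
    qed
    then have "(M * \<delta> powr (\<beta> - 1)) * norm (z' - w') \<le> (M * \<delta> powr (\<beta> - 1)) * \<delta>"
      using M by (intro mult_left_mono) auto
    also have "\<dots> = M * \<delta> powr \<beta>" using \<delta> by (simp add: powr_diff)
    finally show ?thesis .
  qed
  have "norm (u z - u w) = norm ((u z - u z') + (u z' - u w') - (u w - u w'))" by simp
  also have "\<dots> \<le> norm (u z - u z') + norm (u z' - u w') + norm (u w - u w')"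
    by (rule order.trans[OF norm_triangle_ineq4]) (use norm_triangle_ineq[of "u z - u z'" "u z' - u w'"] in simp)
  also have "\<dots> \<le> M * \<delta> powr \<beta> / \<beta> + M * \<delta> powr \<beta> + M * \<delta> powr \<beta> / \<beta>" using 1 2 3 by linarith
  also have "\<dots> = M * (1 + 2 / \<beta>) * \<delta> powr \<beta>" using \<beta> by (simp add: field_simps)
  also have "\<dots> \<le> M * (1 + 2 / \<beta>) * norm (z - w) powr \<beta>"
    using M \<beta> \<delta> \<delta>2 by (intro mult_left_mono powr_mono2) auto
  finally show ?thesis .
qed simp

section \<open>Bloch norms of holomorphic functions\<close>

lemma Lambda_eq_SUP_derivative:
  fixes f :: "complex ^ 'n \<Rightarrow> complex"
  assumes f: "(f has_derivative A) (at z)" and lin: "\<And>c v. A (c *s v) = c * A v"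
  shows "Lambda f z = (SUP \<theta>\<in>sphere 0 1. norm (A \<theta>))"
proof -
  interpret bounded_linear A using f by (rule has_derivative_bounded_linear)
  have ax: "axis k \<i> = \<i> *s axis k (1::complex)" for k :: 'n
    by (simp add: vec_eq_iff axis_def)
  have i: "A (axis k \<i>) = \<i> * A (axis k 1)" for k by (simp only: ax lin)
  \<comment> \<open>The Cauchy-Riemann relation \<open>i\<close> annihilates
    \<open>grad_bar f z\<close>, and the conjugate put on \<open>\<theta>\<close> cancels the one
    inside \<open>herm_inner\<close>; \<open>Lambda\<close> thus becomes the operator norm of the
    complex derivative.\<close>
  have g: "grad f z $ k = A (axis k 1)" "grad_bar f z $ k = 0" for k
    by (simp_all add: grad_def grad_bar_def dir_deriv_eq[OF f] i)
  have "herm_inner (grad f z) (\<chi> k. cnj (\<theta> $ k)) + herm_inner (grad_bar f z) \<theta> = A \<theta>" for \<theta>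
  proof -
    have "A \<theta> = A (\<Sum>k\<in>UNIV. (\<theta> $ k) *s axis k 1)" by (simp add: basis_expansion)
    then show ?thesis by (simp add: herm_inner_def g sum lin mult.commute)
  qed
  then show ?thesis by (simp add: Lambda_def)
qed

lemma Lambda_le:
  fixes f :: "complex ^ 'n \<Rightarrow> complex"
  assumes f: "(f has_derivative A) (at z)" and lin: "\<And>c v. A (c *s v) = c * A v"
    and B: "\<And>v. norm (A v) \<le> B * norm v"
  shows "Lambda f z \<le> B"
  unfolding Lambda_eq_SUP_derivative[OF f lin]
proof (rule cSUP_least)
  show "sphere (0 :: complex ^ 'n) 1 \<noteq> {}" using norm_axis_complex_1 by (metis empty_iff mem_sphere_0)
  fix \<theta> :: "complex ^ 'n" assume "\<theta> \<in> sphere 0 1"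
  then show "norm (A \<theta>) \<le> B" using B[of \<theta>] by simp
qed

lemma norm_derivative_le_Lambda:
  fixes f :: "complex ^ 'n \<Rightarrow> complex"
  assumes f: "(f has_derivative A) (at z)" and lin: "\<And>c v. A (c *s v) = c * A v"
  shows "norm (A v) \<le> Lambda f z * norm v"
proof (cases "v = 0")
  case False
  interpret bounded_linear A using f by (rule has_derivative_bounded_linear)
  obtain K where K: "\<And>x. norm (A x) \<le> norm x * K" using bounded by blast
  have "norm (A (v /\<^sub>R norm v)) \<le> Lambda f z"
    unfolding Lambda_eq_SUP_derivative[OF f lin]
  proof (rule cSUP_upper)
    show "bdd_above ((\<lambda>\<theta>. norm (A \<theta>)) ` sphere 0 1)"
    proof (rule bdd_aboveI2)
      fix \<theta> :: "complex ^ 'n" assume "\<theta> \<in> sphere 0 1"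
      then show "norm (A \<theta>) \<le> K" using K[of \<theta>] by simp
    qed
  qed (use False in simp)
  then show ?thesis using False by (simp add: scaleR field_simps)
next
  case True
  then show ?thesis using linear_0[OF bounded_linear.linear[OF has_derivative_bounded_linear[OF f]]] by simp
qed

text \<open>As \<open>\<omega> (norm z)\<close> is \<open>(1 - norm z) powr (\<beta> - 1)\<close>,
  the supremum in the Bloch norm is the least constant in a weighted bound on the derivative. This
  lemma and the next pass between the two; the value at 0 is discarded on the way back.\<close>

lemma bloch_norm_le:
  fixes f :: "complex ^ 'n \<Rightarrow> complex"
  assumes \<omega>: "\<And>t. t \<in> {0..<1} \<Longrightarrow> \<omega> t = 1 / (1 - t) powr (1 - \<beta>)"
    and f: "\<And>z. z \<in> ball 0 1 \<Longrightarrow> (f has_derivative A z) (at z)"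
    and lin: "\<And>z c v. z \<in> ball 0 1 \<Longrightarrow> A z (c *s v) = c * A z v"
    and B: "\<And>z v. z \<in> ball 0 1 \<Longrightarrow> norm (A z v) \<le> B * (1 - norm z) powr (\<beta> - 1) * norm v"
    and B0: "B \<ge> 0"
  shows "bloch_norm \<omega> f \<le> ennreal (norm (f 0) + B)"
proof -
  have "(SUP z\<in>ball 0 1. ennreal (Lambda f z / \<omega> (norm z))) \<le> ennreal B"
  proof (rule SUP_least, rule ennreal_leI)
    fix z :: "complex ^ 'n" assume z: "z \<in> ball 0 1"
    then have p: "(1 - norm z) powr (1 - \<beta>) > 0" by simp
    have "Lambda f z \<le> B * (1 - norm z) powr (\<beta> - 1)" by (rule Lambda_le[OF f[OF z] lin[OF z] B[OF z]])
    then have "Lambda f z * (1 - norm z) powr (1 - \<beta>) \<le> B * (1 - norm z) powr (\<beta> - 1) * (1 - norm z) powr (1 - \<beta>)"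
      using p by (intro mult_right_mono) auto
    also have "\<dots> = B" using z by (simp add: mult.assoc flip: powr_add)
    finally show "Lambda f z / \<omega> (norm z) \<le> B" using z by (simp add: \<omega>)
  qed
  then show ?thesis unfolding bloch_norm_def using B0 by (simp add: ennreal_plus)
qed

lemma bloch_norm_leD:
  fixes f :: "complex ^ 'n \<Rightarrow> complex"
  assumes \<omega>: "\<And>t. t \<in> {0..<1} \<Longrightarrow> \<omega> t = 1 / (1 - t) powr (1 - \<beta>)"
    and c: "bloch_norm \<omega> f \<le> ennreal c" "c \<ge> 0"
    and z: "z \<in> ball 0 1" and f: "(f has_derivative A) (at z)" and lin: "\<And>c v. A (c *s v) = c * A v"
  shows "norm (A v) \<le> c * (1 - norm z) powr (\<beta> - 1) * norm v"
proof -
  have p: "(1 - norm z) powr (1 - \<beta>) > 0" using z by simp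
  have "ennreal (Lambda f z / \<omega> (norm z)) \<le> (SUP z\<in>ball 0 1. ennreal (Lambda f z / \<omega> (norm z)))"
    by (rule SUP_upper[OF z])
  also have "\<dots> \<le> bloch_norm \<omega> f" unfolding bloch_norm_def by simp
  also note c(1)
  finally have "Lambda f z / \<omega> (norm z) \<le> c" using c(2) by (simp add: ennreal_le_iff)
  then have "Lambda f z * (1 - norm z) powr (1 - \<beta>) \<le> c" using z by (simp add: \<omega>)
  then have "Lambda f z * (1 - norm z) powr (1 - \<beta>) * (1 - norm z) powr (\<beta> - 1) \<le> c * (1 - norm z) powr (\<beta> - 1)"
    by (intro mult_right_mono) auto
  also have "Lambda f z * (1 - norm z) powr (1 - \<beta>) * (1 - norm z) powr (\<beta> - 1) = Lambda f z"
    using z by (simp add: mult.assoc flip: powr_add)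
  finally have "Lambda f z * norm v \<le> c * (1 - norm z) powr (\<beta> - 1) * norm v" by (intro mult_right_mono) auto
  with norm_derivative_le_Lambda[OF f lin, of v] show ?thesis by linarith
qed

text \<open>The exponent is \<open>k = \<lfloor>1 / (1 - r)\<rfloor>\<close>, for which \<open>(k - 1) (1 - r) \<le> r\<close> and hence
  \<open>r ^ (k - 1) \<ge> exp (-1)\<close>.\<close>

lemma exists_good_exponent:
  fixes r :: real
  assumes r: "0 \<le> r" "r < 1" and \<alpha>: "0 < \<alpha>" "\<alpha> < 1"
  obtains k :: nat where "k \<ge> 1" "1 / (2 * (1 - r)) \<le> k"
    "(1 - r) powr (\<alpha> - 1) \<le> 2 * exp 1 * (k powr (1 - \<alpha>) * r ^ (k - 1))"
proof -
  define k where "k = nat \<lfloor>1 / (1 - r)\<rfloor>"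
  have ge1: "1 / (1 - r) \<ge> 1" using r by simp
  then have k1: "k \<ge> 1" unfolding k_def by linarith
  have "real k = of_int \<lfloor>1 / (1 - r)\<rfloor>" unfolding k_def using ge1 by (intro of_nat_nat) linarith
  then have k2: "real k \<le> 1 / (1 - r)" and k3: "1 / (1 - r) < real k + 1" by linarith+
  have k4: "1 / (1 - r) \<le> 2 * real k" using k3 k1 by linarith
  \<comment> \<open>This lower bound pushes the exponent past any prescribed index once
    \<open>r\<close> is close to 1, as the compactness argument requires.\<close>
  have k5: "1 / (2 * (1 - r)) \<le> k" using k4 r by (simp add: field_simps)
  have pow: "exp (-1) \<le> r ^ (k - 1)"
  proof (cases "r = 0")
    case True
    then have "k = 1" by (simp add: k_def)
    then show ?thesis by simp
  next
    case False
    with r have r0: "r > 0" by simp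
    have "real k * (1 - r) \<le> 1" using k2 r by (simp add: field_simps)
    then have "real (k - 1) * (1 - r) \<le> r" using k1 by (simp add: of_nat_diff algebra_simps)
    then have "real (k - 1) * ((1 - r) / r) \<le> 1" using r0 by (simp add: field_simps)
    moreover have "ln (1 / r) \<le> 1 / r - 1" using r0 by (intro ln_le_minus_one) simp
    then have "- ln r \<le> (1 - r) / r" using r0 by (simp add: ln_div diff_divide_distrib)
    then have "real (k - 1) * (- ln r) \<le> real (k - 1) * ((1 - r) / r)" by (intro mult_left_mono) auto
    ultimately have "-1 \<le> real (k - 1) * ln r" by simp
    then have "exp (-1) \<le> exp (real (k - 1) * ln r)" by simp
    also have "\<dots> = r ^ (k - 1)" using r0 by (simp add: exp_of_nat_mult)
    finally show ?thesis .
  qed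
  have "(1 - r) powr (\<alpha> - 1) = (1 / (1 - r)) powr (1 - \<alpha>)" using r by (simp add: powr_divide powr_minus_divide[symmetric])
  also have "\<dots> \<le> (2 * real k) powr (1 - \<alpha>)" using k4 r \<alpha> by (intro powr_mono2) auto
  also have "\<dots> = 2 powr (1 - \<alpha>) * k powr (1 - \<alpha>)" by (simp add: powr_mult)
  also have "\<dots> \<le> 2 * k powr (1 - \<alpha>)" using \<alpha> powr_mono[of "1 - \<alpha>" 1 "2::real"] by (intro mult_right_mono) auto
  also have "\<dots> = 2 * exp 1 * (k powr (1 - \<alpha>) * exp (-1))" by (simp add: exp_minus field_simps)
  also have "\<dots> \<le> 2 * exp 1 * (k powr (1 - \<alpha>) * r ^ (k - 1))"
    using pow by (intro mult_left_mono) auto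
  finally show ?thesis using that k1 k5 by blast
qed

text \<open>Interpolation: with \<open>x = k * norm (z - w)\<close> the difference is at most
  \<open>min x 2\<close>, and \<open>min x 2 \<le> 2 * x powr \<alpha>\<close>. This is the origin
  of the normalization \<open>k powr (- \<alpha>)\<close>.\<close>

lemma power_lipschitz:
  fixes z w :: complex
  assumes z: "norm z \<le> 1" and w: "norm w \<le> 1" and \<alpha>: "0 \<le> \<alpha>" "\<alpha> \<le> 1"
  shows "norm (z ^ k - w ^ k) \<le> 2 * real k powr \<alpha> * norm (z - w) powr \<alpha>"
proof -
  define x where "x = real k * norm (z - w)"
  have x1: "norm (z ^ k - w ^ k) \<le> x"
    unfolding x_def using norm_power_diff[OF z w, of k] .
  have x2: "norm (z ^ k - w ^ k) \<le> 2"
    using norm_triangle_ineq4[of "z ^ k" "w ^ k"] power_le_one[OF norm_ge_zero z, of k] power_le_one[OF norm_ge_zero w, of k]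
    by (simp add: norm_power)
  have x0: "x \<ge> 0" by (simp add: x_def)
  have "norm (z ^ k - w ^ k) \<le> 2 * x powr \<alpha>"
  proof (cases "x \<le> 1")
    case True
    have "x = x powr 1" using x0 by simp
    also have "\<dots> \<le> x powr \<alpha>" using True x0 \<alpha> by (intro powr_mono') auto
    finally show ?thesis using x1 x0 by linarith
  next
    case False
    then have "x powr \<alpha> \<ge> 1" using \<alpha> by (intro ge_one_powr_ge_zero) auto
    then show ?thesis using x2 by linarith
  qed
  then show ?thesis by (simp add: x_def powr_mult mult.assoc)
qed

text \<open>A converse to the Hardy-Littlewood estimate: on the complex line through
  \<open>z\<close> in the unit direction \<open>b\<close>, the slice of \<open>f\<close> lives on a
  disc of radius \<open>1 - norm z\<close>, and Cauchy's inequality turns its oscillation into a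
  derivative bound.\<close>

lemma lipschitz_holomorphic_derivative_bound:
  fixes f :: "complex ^ 'n \<Rightarrow> complex"
  assumes f: "cn_holomorphic_on f (ball 0 1)" and z: "z \<in> ball 0 1"
    and S: "\<And>z w. z \<in> ball 0 1 \<Longrightarrow> w \<in> ball 0 1 \<Longrightarrow> norm (f z - f w) \<le> S * norm (z - w) powr \<beta>"
    and S0: "S \<ge> 0" and \<beta>: "\<beta> \<ge> 0"
    and A: "(f has_derivative A) (at z)" and lin: "\<And>c v. A (c *s v) = c * A v"
  shows "norm (A v) \<le> 2 * S * (1 - norm z) powr (\<beta> - 1) * norm v"
proof (cases "v = 0")
  case True
  then show ?thesis using linear_0[OF bounded_linear.linear[OF has_derivative_bounded_linear[OF A]]] by simp
next
  case False
  interpret bounded_linear A using A by (rule has_derivative_bounded_linear)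
  define r where "r = 1 - norm z"
  have r: "r > 0" using z by (simp add: r_def)
  define b where "b = v /\<^sub>R norm v"
  have b: "norm b = 1" using False by (simp add: b_def)
  have inb: "z + c *s b \<in> ball 0 1" if "c \<in> ball 0 r" for c
    using that norm_triangle_ineq[of z "c *s b"] by (simp add: r_def norm_vector_smult b)
  have "norm (deriv (\<lambda>c. f (z + c *s b) - f z) 0) \<le> 2 * (S * r powr \<beta>) / r"
  proof (rule norm_deriv_le_of_bounded[OF _ r])
    show "(\<lambda>c. f (z + c *s b) - f z) holomorphic_on ball 0 r"
      by (intro holomorphic_intros cn_holomorphic_slice[OF f] inb) auto
    fix c :: complex assume c: "c \<in> ball 0 r"
    have "norm (f (z + c *s b) - f z) \<le> S * norm (z + c *s b - z) powr \<beta>" by (rule S[OF inb[OF c] z])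
    also have "\<dots> \<le> S * r powr \<beta>"
      using c S0 \<beta> by (intro mult_left_mono powr_mono2) (auto simp: norm_vector_smult b)
    finally show "norm (f (z + c *s b) - f z) \<le> S * r powr \<beta>" .
  qed
  moreover have "((\<lambda>c. f (z + c *s b) - f z) has_field_derivative A b) (at 0)"
    using cn_holomorphic_slice_DERIV[of f A z 0 b] A lin by (auto intro!: derivative_eq_intros)
  then have "deriv (\<lambda>c. f (z + c *s b) - f z) 0 = A b" by (rule DERIV_imp_deriv)
  ultimately have "norm (A b) \<le> 2 * (S * r powr \<beta>) / r" by simp
  also have "\<dots> = 2 * S * r powr (\<beta> - 1)" using r by (simp add: powr_diff)
  finally show ?thesis using False by (simp add: b_def scaleR r_def field_simps)
qed

subsection \<open>Lipschitz spaces and composition\<close>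

lemma lip_space_bound:
  assumes f: "f \<in> lip_space a" and z: "z \<in> ball 0 1" and w: "w \<in> ball 0 1"
  shows "norm (f z - f w) \<le> Sup (lip_quotients a f) * norm (z - w) powr a"
proof (cases "z = w")
  case False
  have "norm (f z - f w) / norm (z - w) powr a \<le> Sup (lip_quotients a f)"
    using f z w False unfolding lip_space_def by (intro cSup_upper) (auto simp: lip_quotients_def)
  then show ?thesis using False by (simp add: divide_le_eq)
qed simp

lemma lip_quotients_nonempty:
  "lip_quotients a (f :: 'a::euclidean_space \<Rightarrow> complex) \<noteq> {}"
proof -
  obtain b :: 'a where b: "b \<in> Basis" using nonempty_Basis by blast
  have "norm (f (b /\<^sub>R 2) - f 0) / norm (b /\<^sub>R 2 - 0) powr a \<in> lip_quotients a f"
    unfolding lip_quotients_def using b by (intro CollectI exI[of _ "b /\<^sub>R 2"] exI[of _ 0]) (auto simp: nonzero_Basis)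
  then show ?thesis by blast
qed

lemma lip_seminorm_nonneg:
  fixes f :: "'a::euclidean_space \<Rightarrow> complex"
  assumes f: "f \<in> lip_space a"
  shows "0 \<le> Sup (lip_quotients a f)"
proof -
  obtain x where x: "x \<in> lip_quotients a f" using lip_quotients_nonempty[of a f] by blast
  then have "0 \<le> x" by (auto simp: lip_quotients_def)
  also have "x \<le> Sup (lip_quotients a f)" using f x by (intro cSup_upper) (auto simp: lip_space_def)
  finally show ?thesis .
qed

lemma lip_spaceI:
  fixes f :: "'a::euclidean_space \<Rightarrow> complex"
  assumes c: "continuous_on (ball 0 1) f"
    and S: "\<And>z w. z \<in> ball 0 1 \<Longrightarrow> w \<in> ball 0 1 \<Longrightarrow> norm (f z - f w) \<le> S * norm (z - w) powr a"
  shows "f \<in> lip_space a" "Sup (lip_quotients a f) \<le> S"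
proof -
  have *: "x \<le> S" if "x \<in> lip_quotients a f" for x
    using that S unfolding lip_quotients_def by (auto simp: divide_le_eq)
  then show "f \<in> lip_space a" unfolding lip_space_def using c by (auto intro: bdd_aboveI[of _ S])
  show "Sup (lip_quotients a f) \<le> S" using * lip_quotients_nonempty by (intro cSup_least) auto
qed

lemma lip_norm_bounds:
  fixes f :: "'a::euclidean_space \<Rightarrow> complex"
  assumes "f \<in> lip_space a"
  shows "norm (f 0) \<le> lip_norm a f" "Sup (lip_quotients a f) \<le> lip_norm a f" "0 \<le> lip_norm a f"
  using lip_seminorm_nonneg[OF assms] by (auto simp: lip_norm_def)

text \<open>Points of the ball have norm below 1, so the Lipschitz norm dominates all values.
  Convergence in norm is then pointwise, which identifies limits in the compactness
  argument.\<close>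

lemma lip_norm_bound:
  fixes f :: "'a::euclidean_space \<Rightarrow> complex"
  assumes f: "f \<in> lip_space a" and z: "z \<in> ball 0 1" and a: "0 \<le> a"
  shows "norm (f z) \<le> lip_norm a f"
proof -
  have "norm (f z) \<le> norm (f 0) + norm (f z - f 0)" by (rule norm_triangle_sub)
  also have "norm (f z - f 0) \<le> Sup (lip_quotients a f) * norm (z - 0) powr a"
    using f z by (intro lip_space_bound) auto
  also have "\<dots> \<le> Sup (lip_quotients a f) * 1"
    using z a lip_seminorm_nonneg[OF f] powr_mono2[of a "norm z" 1] by (intro mult_left_mono) auto
  finally show ?thesis by (simp add: lip_norm_def)
qed

lemma lip_norm_cong:
  assumes "\<And>z. z \<in> ball 0 1 \<Longrightarrow> f z = g z"
  shows "lip_norm a f = lip_norm a g"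
proof -
  have sub: "lip_quotients a f \<subseteq> lip_quotients a g" if fg: "\<And>z. z \<in> ball 0 1 \<Longrightarrow> f z = g z" for f g :: "'a \<Rightarrow> complex"
  proof
    fix x assume "x \<in> lip_quotients a f"
    then obtain z w where zw: "z \<in> ball 0 1" "w \<in> ball 0 1" "z \<noteq> w"
      and x: "x = norm (f z - f w) / norm (z - w) powr a"
      unfolding lip_quotients_def by blast
    have "x = norm (g z - g w) / norm (z - w) powr a" unfolding x fg[OF zw(1)] fg[OF zw(2)] ..
    with zw show "x \<in> lip_quotients a g" unfolding lip_quotients_def by blast
  qed
  have "lip_quotients a f = lip_quotients a g"
    using assms by (intro equalityI sub) simp_all
  then show ?thesis using assms[of 0] by (simp add: lip_norm_def)
qed

lemma lip_space_diff:
  fixes f g :: "'a::euclidean_space \<Rightarrow> complex"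
  assumes f: "f \<in> lip_space a" and g: "g \<in> lip_space a"
  shows "(\<lambda>z. f z - g z) \<in> lip_space a"
    "Sup (lip_quotients a (\<lambda>z. f z - g z)) \<le> Sup (lip_quotients a f) + Sup (lip_quotients a g)"
proof -
  have c: "continuous_on (ball 0 1) (\<lambda>z. f z - g z)"
    using f g by (auto simp: lip_space_def intro!: continuous_intros)
  have b: "norm ((f z - g z) - (f w - g w)) \<le> (Sup (lip_quotients a f) + Sup (lip_quotients a g)) * norm (z - w) powr a"
    if "z \<in> ball 0 1" "w \<in> ball 0 1" for z w
  proof -
    have "norm ((f z - g z) - (f w - g w)) = norm ((f z - f w) - (g z - g w))" by (simp add: algebra_simps)
    also have "\<dots> \<le> norm (f z - f w) + norm (g z - g w)" by (rule norm_triangle_ineq4)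
    finally show ?thesis using lip_space_bound[OF f that] lip_space_bound[OF g that] by (simp add: algebra_simps)
  qed
  show "(\<lambda>z. f z - g z) \<in> lip_space a"
    "Sup (lip_quotients a (\<lambda>z. f z - g z)) \<le> Sup (lip_quotients a f) + Sup (lip_quotients a g)"
    using lip_spaceI[OF c b] by blast+
qed

text \<open>The summands are unique only up to a constant. Fixing \<open>g 0 = 0\<close> makes
  \<open>h 0 = f 0\<close>, so both summands stay bounded at 0 when \<open>f\<close> ranges over a
  bounded set, as a normal family argument demands.\<close>

lemma harmonic_normalized_decomposition:
  assumes f: "harmonic_on f (ball 0 1)"
  obtains h g where "h holomorphic_on ball 0 1" "g holomorphic_on ball 0 1" "g 0 = 0"
    "\<And>z. z \<in> ball 0 1 \<Longrightarrow> f z = h z + cnj (g z)"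
proof -
  obtain h g where "h holomorphic_on ball 0 1" "g holomorphic_on ball 0 1"
    "\<And>z. z \<in> ball 0 1 \<Longrightarrow> f z = h z + cnj (g z)"
    using harmonic_imp_holomorphic_plus_cnj[OF f] by blast
  then show ?thesis
    by (intro that[of "\<lambda>z. h z + cnj (g 0)" "\<lambda>z. g z - g 0"]) (auto intro!: holomorphic_intros)
qed

text \<open>Convergence to 0 in the extended reals leaves finitely many terms free to be infinite;
  \<open>fin\<close> excludes that. The constant is 1 for the tail plus the sum of the initial
  terms.\<close>

lemma ennreal_bounded_of_tendsto_0:
  fixes b :: "nat \<Rightarrow> ennreal"
  assumes fin: "\<And>k. k \<ge> 1 \<Longrightarrow> b k < \<infinity>" and lim: "b \<longlonglongrightarrow> 0"
  obtains c where "c \<ge> 0" "\<And>k. k \<ge> 1 \<Longrightarrow> b k \<le> ennreal c"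
proof -
  have "\<forall>\<^sub>F k in sequentially. b k < 1" by (rule order_tendstoD(2)[OF lim]) simp
  then obtain N where N: "\<And>k. k \<ge> N \<Longrightarrow> b k < 1" unfolding eventually_sequentially by blast
  define c where "c = 1 + (\<Sum>k<N. enn2real (b k))"
  have s: "(\<Sum>k<N. enn2real (b k)) \<ge> 0" by (intro sum_nonneg) simp
  have "b k \<le> ennreal c" if k: "k \<ge> 1" for k
  proof (cases "k < N")
    case True
    then have "enn2real (b k) \<le> c"
      unfolding c_def using member_le_sum[of k "{..<N}" "\<lambda>k. enn2real (b k)"] by (simp add: add_increasing)
    then have "ennreal (enn2real (b k)) \<le> ennreal c" by (rule ennreal_leI)
    moreover have "ennreal (enn2real (b k)) = b k"
      using fin[OF k] by (intro ennreal_enn2real) (simp only: infinity_ennreal_def)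
    ultimately show ?thesis by (simp only:)
  next
    case False
    then have "b k \<le> ennreal 1" using N[of k] by (simp add: less_imp_le)
    also have "\<dots> \<le> ennreal c" using s by (intro ennreal_leI) (simp add: c_def)
    finally show ?thesis .
  qed
  then show ?thesis using that[of c] s by (simp add: c_def)
qed

section \<open>Estimates for a fixed holomorphic map into the disc\<close>

locale lipschitz_composition =
  fixes \<alpha> \<beta> :: real and \<omega> :: "real \<Rightarrow> real" and \<phi> :: "complex ^ 'n \<Rightarrow> complex"
  assumes \<alpha>: "0 < \<alpha>" "\<alpha> < 1" and \<beta>: "0 < \<beta>" "\<beta> < 1"
    and \<omega>: "\<And>t. t \<in> {0..<1} \<Longrightarrow> \<omega> t = 1 / (1 - t) powr (1 - \<beta>)"
    and \<phi>_hol: "cn_holomorphic_on \<phi> (ball 0 1)"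
    and \<phi>_into: "\<phi> ` ball 0 1 \<subseteq> ball 0 1"
begin

text \<open>\<open>D z\<close> is the complex derivative of \<phi> and \<open>W z\<close> the value
  \<open>\<omega> (norm z)\<close>. Bounds keep the direction \<open>v\<close> explicit in place of
  an operator norm.\<close>

abbreviation "D z \<equiv> blinfun_apply (cn_total \<phi> z)"
abbreviation "W z \<equiv> (1 - norm (z :: complex ^ 'n)) powr (\<beta> - 1)"
abbreviation "X \<equiv> lip_space \<alpha> \<inter> PH_disc"
abbreviation "Y \<equiv> lip_space \<beta> \<inter> (PH_ball :: (complex ^ 'n \<Rightarrow> complex) set)"
text \<open>At \<open>k = 0\<close> the factor \<open>0 powr (- \<alpha>)\<close> is 0, so that term
  vanishes.\<close>

abbreviation "scaled_bloch k \<equiv> ennreal (real k powr (- \<alpha>)) * bloch_norm \<omega> (\<lambda>z. \<phi> z ^ k)"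

lemma \<phi>_in: "z \<in> ball 0 1 \<Longrightarrow> \<phi> z \<in> ball 0 1"
  using \<phi>_into by blast

lemma D: "z \<in> ball 0 1 \<Longrightarrow> (\<phi> has_derivative D z) (at z)"
  by (rule cn_total_has_derivative[OF \<phi>_hol])

lemma D_smult: "D z (c *s v) = c * D z v"
  by (simp add: cn_total_def blinfun.sum_left sum_distrib_left mult_ac)

lemma power_cn_holomorphic: "cn_holomorphic_on (\<lambda>z. \<phi> z ^ k) (ball 0 1)"
  using cn_holomorphic_compose[OF \<phi>_hol holomorphic_on_power[OF holomorphic_on_ident] open_UNIV subset_UNIV, of k]
  by (simp add: o_def)

lemma power_derivative:
  assumes "z \<in> ball 0 1"
  shows "((\<lambda>z. \<phi> z ^ k) has_derivative (\<lambda>v. of_nat k * \<phi> z ^ (k - 1) * D z v)) (at z)"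
  by (rule has_derivative_eq_rhs[OF has_derivative_power[OF D[OF assms]]]) (simp add: mult_ac)

text \<open>The chain rule contributes a factor \<open>k\<close>, and
  \<open>k * k powr (- \<alpha>)\<close> is \<open>k powr (1 - \<alpha>)\<close>. The scaling is
  undone by multiplying with \<open>k powr \<alpha>\<close> in the extended reals before passing to
  reals.\<close>

lemma scaled_bloch_leD:
  assumes k: "k \<ge> 1" and c: "scaled_bloch k \<le> ennreal c" "c \<ge> 0" and z: "z \<in> ball 0 1"
  shows "k powr (1 - \<alpha>) * norm (\<phi> z) ^ (k - 1) * norm (D z v) \<le> c * W z * norm v"
proof -
  have k0: "real k > 0" using k by simp
  have "k powr \<alpha> * k powr - \<alpha> = 1" using k0 by (simp add: powr_minus)
  then have "ennreal (k powr \<alpha>) * ennreal (k powr - \<alpha>) = 1"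
    by (simp flip: ennreal_mult')
  then have "bloch_norm \<omega> (\<lambda>z. \<phi> z ^ k) = ennreal (k powr \<alpha>) * scaled_bloch k"
    by (simp only: mult_1 flip: mult.assoc)
  also have "\<dots> \<le> ennreal (k powr \<alpha>) * ennreal c" by (intro mult_left_mono c) auto
  also have "\<dots> = ennreal (k powr \<alpha> * c)" using c(2) by (simp add: ennreal_mult)
  finally have "norm (of_nat k * \<phi> z ^ (k - 1) * D z v) \<le> (k powr \<alpha> * c) * W z * norm v"
    using c(2) by (intro bloch_norm_leD[OF \<omega> _ _ z power_derivative[OF z]]) (auto simp: D_smult)
  then have "real k * (norm (\<phi> z) ^ (k - 1) * norm (D z v)) \<le> k powr \<alpha> * (c * W z * norm v)"
    by (simp add: norm_mult norm_power mult.assoc)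
  moreover have kk: "k powr \<alpha> * k powr (1 - \<alpha>) = real k" using k0 by (simp flip: powr_add)
  have "k powr \<alpha> * (k powr (1 - \<alpha>) * norm (\<phi> z) ^ (k - 1) * norm (D z v))
      = (k powr \<alpha> * k powr (1 - \<alpha>)) * (norm (\<phi> z) ^ (k - 1) * norm (D z v))" by (simp only: mult.assoc)
  ultimately have "k powr \<alpha> * (k powr (1 - \<alpha>) * norm (\<phi> z) ^ (k - 1) * norm (D z v)) \<le> k powr \<alpha> * (c * W z * norm v)"
    by (simp only: kk)
  then show ?thesis using k0 by (simp add: mult_le_cancel_left_pos)
qed

text \<open>The index \<open>k0\<close> lets one statement serve both criteria: either all powers
  are controlled, or only those from \<open>k0\<close> on, and then \<open>\<phi> z\<close> must be
  so close to the circle that the exponent adapted to it, at least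
  \<open>1 / (2 * (1 - norm (\<phi> z)))\<close>, is at least \<open>k0\<close>.\<close>

lemma weighted_derivative_bound:
  fixes k0 :: nat
  assumes c: "\<And>k. k \<ge> 1 \<Longrightarrow> k \<ge> k0 \<Longrightarrow> scaled_bloch k \<le> ennreal c" "c \<ge> 0" and z: "z \<in> ball 0 1"
    and k0: "k0 \<le> 1 \<or> 2 * k0 * (1 - norm (\<phi> z)) \<le> 1"
  shows "(1 - norm (\<phi> z)) powr (\<alpha> - 1) * norm (D z v) \<le> 2 * exp 1 * c * W z * norm v"
proof -
  have r: "0 \<le> norm (\<phi> z)" "norm (\<phi> z) < 1" using \<phi>_in[OF z] by auto
  obtain k where k: "k \<ge> 1" "1 / (2 * (1 - norm (\<phi> z))) \<le> real k"
    "(1 - norm (\<phi> z)) powr (\<alpha> - 1) \<le> 2 * exp 1 * (k powr (1 - \<alpha>) * norm (\<phi> z) ^ (k - 1))"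
    using exists_good_exponent[OF r \<alpha>] by blast
  have "k \<ge> k0"
  proof (cases "k0 \<le> 1")
    case False
    with k0 have "real k0 \<le> 1 / (2 * (1 - norm (\<phi> z)))" using r by (simp add: field_simps)
    with k(2) show ?thesis by linarith
  qed (use k in simp)
  with k c have le: "scaled_bloch k \<le> ennreal c" by blast
  have "(1 - norm (\<phi> z)) powr (\<alpha> - 1) * norm (D z v) \<le> 2 * exp 1 * (k powr (1 - \<alpha>) * norm (\<phi> z) ^ (k - 1)) * norm (D z v)"
    using k(3) by (intro mult_right_mono) auto
  also have "\<dots> = 2 * exp 1 * (k powr (1 - \<alpha>) * norm (\<phi> z) ^ (k - 1) * norm (D z v))" by simp
  also have "\<dots> \<le> 2 * exp 1 * (c * W z * norm v)"
    by (intro mult_left_mono scaled_bloch_leD[OF k(1) le c(2) z]) auto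
  finally show ?thesis by (simp add: mult_ac)
qed

text \<open>The decomposition passes to \<open>f \<circ> \<phi>\<close>, whose derivative
  \<open>A z\<close> is in general only real linear; the Hardy-Littlewood estimate is stated for
  real derivatives and applies to it.\<close>

lemma
  assumes h: "h holomorphic_on ball 0 1" and g: "g holomorphic_on ball 0 1"
    and f: "\<And>z. z \<in> ball 0 1 \<Longrightarrow> f z = h z + cnj (g z)"
  shows compose_PH: "f \<circ> \<phi> \<in> PH_ball"
    and compose_continuous: "continuous_on (ball 0 1) (f \<circ> \<phi>)"
    and compose_lipschitz: "\<lbrakk>\<And>z v. z \<in> ball 0 1 \<Longrightarrow> (norm (deriv h (\<phi> z)) + norm (deriv g (\<phi> z))) * norm (D z v) \<le> M * W z * norm v;
       0 \<le> M; z \<in> ball 0 1; w \<in> ball 0 1\<rbrakk> \<Longrightarrow>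
       norm ((f \<circ> \<phi>) z - (f \<circ> \<phi>) w) \<le> M * (1 + 2 / \<beta>) * norm (z - w) powr \<beta>"
proof -
  note hh = cn_holomorphic_compose[OF \<phi>_hol h open_ball \<phi>_into]
  note gg = cn_holomorphic_compose[OF \<phi>_hol g open_ball \<phi>_into]
  have f\<phi>: "(f \<circ> \<phi>) z = (h \<circ> \<phi>) z + cnj ((g \<circ> \<phi>) z)" if "z \<in> ball 0 1" for z
    using f[OF \<phi>_in[OF that]] by simp
  show "f \<circ> \<phi> \<in> PH_ball" unfolding PH_ball_def
    using pluriharmonic_on_cn_holomorphic_plus_cnj[OF open_ball hh gg f\<phi>] by blast
  have "continuous_on (ball 0 1) (\<lambda>z. (h \<circ> \<phi>) z + cnj ((g \<circ> \<phi>) z))"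
    by (intro continuous_intros cn_holomorphic_imp_continuous_on hh gg)
  then show "continuous_on (ball 0 1) (f \<circ> \<phi>)" by (rule continuous_on_eq) (simp only: f\<phi>)
  assume M: "\<And>z v. z \<in> ball 0 1 \<Longrightarrow> (norm (deriv h (\<phi> z)) + norm (deriv g (\<phi> z))) * norm (D z v) \<le> M * W z * norm v" "0 \<le> M"
    and z: "z \<in> ball 0 1" and w: "w \<in> ball 0 1"
  define A where "A = (\<lambda>z v. deriv h (\<phi> z) * D z v + cnj (deriv g (\<phi> z) * D z v))"
  have der: "(f \<circ> \<phi> has_derivative A z) (at z)" if z: "z \<in> ball 0 1" for z
  proof -
    have "(h has_derivative (*) (deriv h (\<phi> z))) (at (\<phi> z))"
      using holomorphic_derivI[OF h open_ball \<phi>_in[OF z]] by (simp add: has_field_derivative_def)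
    note 1 = has_derivative_compose[OF D[OF z] this]
    have "(g has_derivative (*) (deriv g (\<phi> z))) (at (\<phi> z))"
      using holomorphic_derivI[OF g open_ball \<phi>_in[OF z]] by (simp add: has_field_derivative_def)
    note 2 = has_derivative_compose[OF D[OF z] this]
    have "((\<lambda>z. h (\<phi> z) + cnj (g (\<phi> z))) has_derivative A z) (at z)"
      unfolding A_def by (intro has_derivative_add has_derivative_cnj 1 2)
    then show ?thesis by (rule has_derivative_transform_within_open[OF _ open_ball z]) (simp only: o_apply f \<phi>_in)
  qed
  have bd: "norm (A z v) \<le> M * W z * norm v" if z: "z \<in> ball 0 1" for z v
  proof -
    have "norm (A z v) \<le> norm (deriv h (\<phi> z) * D z v) + norm (cnj (deriv g (\<phi> z) * D z v))"
      unfolding A_def by (rule norm_triangle_ineq)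
    also have "\<dots> = (norm (deriv h (\<phi> z)) + norm (deriv g (\<phi> z))) * norm (D z v)"
      by (simp add: norm_mult distrib_right)
    finally show ?thesis using M(1)[OF z, of v] by linarith
  qed
  show "norm ((f \<circ> \<phi>) z - (f \<circ> \<phi>) w) \<le> M * (1 + 2 / \<beta>) * norm (z - w) powr \<beta>"
    by (rule hardy_littlewood_lipschitz[OF der bd M(2) _ _ z w]) (use \<beta> in auto)
qed

lemma compose_in_Y:
  assumes C: "\<And>z v. z \<in> ball 0 1 \<Longrightarrow> (1 - norm (\<phi> z)) powr (\<alpha> - 1) * norm (D z v) \<le> C * W z * norm v" "C \<ge> 0"
    and f: "f \<in> X"
  shows "f \<circ> \<phi> \<in> Y" "lip_norm \<beta> (f \<circ> \<phi>) \<le> (1 + 8 * C * (1 + 2 / \<beta>)) * lip_norm \<alpha> f"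
proof -
  define S where "S = Sup (lip_quotients \<alpha> f)"
  have S0: "S \<ge> 0" using lip_seminorm_nonneg f by (auto simp: S_def)
  have S: "norm (f z - f w) \<le> S * norm (z - w) powr \<alpha>" if "z \<in> ball 0 1" "w \<in> ball 0 1" for z w
    using lip_space_bound[of f \<alpha>] that f by (auto simp: S_def simp del: mem_ball)
  obtain h g where h: "h holomorphic_on ball 0 1" and g: "g holomorphic_on ball 0 1"
    and hg: "\<And>z. z \<in> ball 0 1 \<Longrightarrow> f z = h z + cnj (g z)"
    using harmonic_imp_holomorphic_plus_cnj[of f] f by (auto simp: PH_disc_def simp del: mem_ball)
  have M: "(norm (deriv h (\<phi> z)) + norm (deriv g (\<phi> z))) * norm (D z v) \<le> (8 * S * C) * W z * norm v" if z: "z \<in> ball 0 1" for z v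
  proof -
    have "(norm (deriv h (\<phi> z)) + norm (deriv g (\<phi> z))) * norm (D z v)
        \<le> 8 * S * (1 - norm (\<phi> z)) powr (\<alpha> - 1) * norm (D z v)"
      using \<alpha> by (intro mult_right_mono lipschitz_deriv_bound[OF h g hg S S0 _ \<phi>_in[OF z]]) auto
    also have "\<dots> = 8 * S * ((1 - norm (\<phi> z)) powr (\<alpha> - 1) * norm (D z v))" by simp
    also have "\<dots> \<le> 8 * S * (C * W z * norm v)" using S0 by (intro mult_left_mono C z) auto
    finally show ?thesis by (simp add: mult_ac)
  qed
  have M0: "0 \<le> 8 * S * C" using S0 C by simp
  note L = lip_spaceI[OF compose_continuous[OF h g hg] compose_lipschitz[OF h g hg M M0]]
  show "f \<circ> \<phi> \<in> Y" using L(1) compose_PH[OF h g hg] by blast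
  \<comment> \<open>Composition moves the base point from 0 to \<open>\<phi> 0\<close>; this costs
    one seminorm \<open>S\<close> and accounts for the 1 in the constant.\<close>
  have "norm (f (\<phi> 0)) \<le> norm (f 0) + norm (f (\<phi> 0) - f 0)" by (rule norm_triangle_sub)
  also have "norm (f (\<phi> 0) - f 0) \<le> S * norm (\<phi> 0 - 0) powr \<alpha>" by (intro S \<phi>_in) auto
  also have "\<dots> \<le> S * 1"
    using \<phi>_in[of 0] \<alpha> S0 powr_mono2[of \<alpha> "norm (\<phi> 0)" 1] by (intro mult_left_mono) auto
  finally have "lip_norm \<beta> (f \<circ> \<phi>) \<le> norm (f 0) + S + 8 * S * C * (1 + 2 / \<beta>)"
    using L(2) by (simp add: lip_norm_def o_def)
  also have "\<dots> \<le> (1 + 8 * C * (1 + 2 / \<beta>)) * (norm (f 0) + S)"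
  proof -
    have "0 \<le> 8 * C * (1 + 2 / \<beta>) * norm (f 0)" using C(2) \<beta> by simp
    moreover have "(1 + 8 * C * (1 + 2 / \<beta>)) * (norm (f 0) + S)
        = norm (f 0) + S + 8 * S * C * (1 + 2 / \<beta>) + 8 * C * (1 + 2 / \<beta>) * norm (f 0)"
      by (simp only: distrib_left distrib_right mult_ac mult_1 add_ac)
    ultimately show ?thesis by linarith
  qed
  finally show "lip_norm \<beta> (f \<circ> \<phi>) \<le> (1 + 8 * C * (1 + 2 / \<beta>)) * lip_norm \<alpha> f"
    by (simp add: lip_norm_def S_def)
qed

lemma linear_operator_comp:
  assumes "\<And>f. f \<in> X \<Longrightarrow> f \<circ> \<phi> \<in> Y"
  shows "linear_operator X Y (comp_operator \<phi>)"
  using assms by (auto simp: linear_operator_def comp_operator_def o_def)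

lemma bloch_norm_le_lip_norm:
  assumes f: "cn_holomorphic_on f (ball 0 1)" "f \<in> lip_space \<beta>"
  shows "bloch_norm \<omega> f \<le> ennreal (2 * lip_norm \<beta> f)"
proof -
  define S where "S = Sup (lip_quotients \<beta> f)"
  have S0: "S \<ge> 0" using lip_seminorm_nonneg f by (auto simp: S_def)
  have S: "norm (f z - f w) \<le> S * norm (z - w) powr \<beta>" if "z \<in> ball 0 1" "w \<in> ball 0 1" for z w
    using lip_space_bound[of f \<beta>] that f by (auto simp: S_def simp del: mem_ball)
  have lin: "cn_total f z (c *s v) = c * cn_total f z v" for z c v
    by (simp add: cn_total_def blinfun.sum_left sum_distrib_left mult_ac)
  note der = cn_total_has_derivative[OF f(1)]
  have "bloch_norm \<omega> f \<le> ennreal (norm (f 0) + 2 * S)"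
    using S0 \<beta> by (intro bloch_norm_le[OF \<omega> der lin] lipschitz_holomorphic_derivative_bound[OF f(1) _ S _ _ der lin]) auto
  also have "\<dots> \<le> ennreal (2 * lip_norm \<beta> f)"
    by (intro ennreal_leI) (simp add: lip_norm_def S_def)
  finally show ?thesis .
qed

lemma power_in_X:
  "(\<lambda>w. a * w ^ k) \<in> X" "Sup (lip_quotients \<alpha> (\<lambda>w. a * w ^ k)) \<le> 2 * norm a * k powr \<alpha>"
proof -
  have b: "norm (a * z ^ k - a * w ^ k) \<le> 2 * norm a * k powr \<alpha> * norm (z - w) powr \<alpha>" if "z \<in> ball 0 1" "w \<in> ball 0 1" for z w
  proof -
    have "norm (a * z ^ k - a * w ^ k) = norm a * norm (z ^ k - w ^ k)"
      by (simp flip: right_diff_distrib norm_mult)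
    also have "\<dots> \<le> norm a * (2 * k powr \<alpha> * norm (z - w) powr \<alpha>)"
      using that \<alpha> by (intro mult_left_mono power_lipschitz) auto
    finally show ?thesis by (simp add: mult_ac)
  qed
  have "continuous_on (ball 0 1) (\<lambda>w. a * w ^ k)" by (intro continuous_intros)
  note L = lip_spaceI[OF this b]
  have "harmonic_on (\<lambda>w. a * w ^ k) (ball 0 1)"
    by (rule harmonic_on_holomorphic_plus_cnj[where h = "\<lambda>w. a * w ^ k" and g = "\<lambda>_. 0"]) (auto intro!: holomorphic_intros)
  then show "(\<lambda>w. a * w ^ k) \<in> X" using L(1) by (simp add: PH_disc_def)
  show "Sup (lip_quotients \<alpha> (\<lambda>w. a * w ^ k)) \<le> 2 * norm a * k powr \<alpha>" by (rule L(2))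
qed

lemma lip_norm_power_le: "k \<ge> 1 \<Longrightarrow> lip_norm \<alpha> (\<lambda>w. a * w ^ k) \<le> 2 * norm a * k powr \<alpha>"
  using power_in_X(2)[of a k] by (cases k) (simp_all add: lip_norm_def)

section \<open>The boundedness criterion\<close>

lemma bounded_iff:
  "bounded_operator X (lip_norm \<alpha>) Y (lip_norm \<beta>) (comp_operator \<phi>) \<longleftrightarrow> (SUP k\<in>{1..}. scaled_bloch k) < \<infinity>"
proof
  assume "bounded_operator X (lip_norm \<alpha>) Y (lip_norm \<beta>) (comp_operator \<phi>)"
  then obtain C where Y: "\<And>f. f \<in> X \<Longrightarrow> f \<circ> \<phi> \<in> Y"
    and C: "\<And>f. f \<in> X \<Longrightarrow> lip_norm \<beta> (f \<circ> \<phi>) \<le> C * lip_norm \<alpha> f"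
    unfolding bounded_operator_def linear_operator_def comp_operator_def by blast
  \<comment> \<open>The 4 combines a factor 2 from the Lipschitz norm of \<open>w ^ k\<close>, at
    most \<open>2 * k powr \<alpha>\<close>, with a factor 2 from comparing Bloch and Lipschitz
    norms; the absolute value allows for a negative \<open>C\<close>.\<close>
  have "scaled_bloch k \<le> ennreal (4 * \<bar>C\<bar>)" if k: "k \<ge> 1" for k
  proof -
    have X: "(\<lambda>w. w ^ k) \<in> X" using power_in_X(1)[of 1 k] by simp
    have n: "0 \<le> lip_norm \<alpha> (\<lambda>w. w ^ k)" using X by (intro lip_norm_bounds) auto
    have "lip_norm \<beta> (\<lambda>z. \<phi> z ^ k) \<le> C * lip_norm \<alpha> (\<lambda>w. w ^ k)" using C[OF X] by (simp add: o_def)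
    also have "\<dots> \<le> \<bar>C\<bar> * lip_norm \<alpha> (\<lambda>w. w ^ k)" using n by (intro mult_right_mono) auto
    also have "\<dots> \<le> \<bar>C\<bar> * (2 * k powr \<alpha>)" using lip_norm_power_le[OF k, of 1] by (intro mult_left_mono) auto
    finally have "2 * lip_norm \<beta> (\<lambda>z. \<phi> z ^ k) \<le> 4 * \<bar>C\<bar> * k powr \<alpha>" by simp
    moreover have "bloch_norm \<omega> (\<lambda>z. \<phi> z ^ k) \<le> ennreal (2 * lip_norm \<beta> (\<lambda>z. \<phi> z ^ k))"
      using Y[OF X] by (intro bloch_norm_le_lip_norm power_cn_holomorphic) (simp add: o_def)
    ultimately have "bloch_norm \<omega> (\<lambda>z. \<phi> z ^ k) \<le> ennreal (4 * \<bar>C\<bar> * k powr \<alpha>)"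
      by (meson ennreal_leI order_trans)
    then have "scaled_bloch k \<le> ennreal (k powr - \<alpha>) * ennreal (4 * \<bar>C\<bar> * k powr \<alpha>)" by (intro mult_left_mono) auto
    also have "\<dots> = ennreal (k powr - \<alpha> * (4 * \<bar>C\<bar> * k powr \<alpha>))" by (simp add: ennreal_mult)
    also have "k powr - \<alpha> * (4 * \<bar>C\<bar> * k powr \<alpha>) = 4 * \<bar>C\<bar>" using k by (simp add: powr_minus)
    finally show ?thesis .
  qed
  then have "(SUP k\<in>{1..}. scaled_bloch k) \<le> ennreal (4 * \<bar>C\<bar>)" by (intro SUP_least) auto
  also have "\<dots> < \<infinity>" by simp
  finally show "(SUP k\<in>{1..}. scaled_bloch k) < \<infinity>" .
next
  assume fin: "(SUP k\<in>{1..}. scaled_bloch k) < \<infinity>"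
  define c where "c = enn2real (SUP k\<in>{1..}. scaled_bloch k)"
  have c0: "c \<ge> 0" by (simp add: c_def)
  have "(SUP k\<in>{1..}. scaled_bloch k) = ennreal c" using fin by (simp add: c_def)
  then have cb: "scaled_bloch k \<le> ennreal c" if "k \<ge> 1" for k
    using SUP_upper[of k "{1..}" scaled_bloch] that by simp
  have C: "(1 - norm (\<phi> z)) powr (\<alpha> - 1) * norm (D z v) \<le> 2 * exp 1 * c * W z * norm v" if "z \<in> ball 0 1" for z v
    by (rule weighted_derivative_bound[of 0, OF cb c0 that]) simp_all
  have "0 \<le> 2 * exp 1 * c" using c0 by simp
  have Y: "f \<circ> \<phi> \<in> Y" "lip_norm \<beta> (f \<circ> \<phi>) \<le> (1 + 8 * (2 * exp 1 * c) * (1 + 2 / \<beta>)) * lip_norm \<alpha> f" if "f \<in> X" for f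
    by (rule compose_in_Y[OF C \<open>0 \<le> 2 * exp 1 * c\<close> that], assumption)+
  show "bounded_operator X (lip_norm \<alpha>) Y (lip_norm \<beta>) (comp_operator \<phi>)"
    unfolding bounded_operator_def
  proof (intro conjI exI ballI)
    show "linear_operator X Y (comp_operator \<phi>)" by (rule linear_operator_comp[OF Y(1)])
    show "lip_norm \<beta> (comp_operator \<phi> f) \<le> (1 + 8 * (2 * exp 1 * c) * (1 + 2 / \<beta>)) * lip_norm \<alpha> f" if "f \<in> X" for f
      using Y(2)[OF that] by (simp add: comp_operator_def)
  qed
qed

section \<open>The compactness criterion\<close>

lemma compact_imp_limit:
  assumes comp: "compact_operator X (lip_norm \<alpha>) Y (lip_norm \<beta>) (comp_operator \<phi>)"
  shows "\<forall>k\<ge>1. bloch_norm \<omega> (\<lambda>z. \<phi> z ^ k) < \<infinity>" and "scaled_bloch \<longlonglongrightarrow> 0"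
proof -
  have Y: "f \<circ> \<phi> \<in> Y" if "f \<in> X" for f
    using comp that unfolding compact_operator_def linear_operator_def comp_operator_def by blast
  define F where "F = (\<lambda>(k::nat) w::complex. complex_of_real (k powr - \<alpha>) * w ^ k)"
  have FX: "F k \<in> X" for k unfolding F_def by (rule power_in_X)
  have FY: "F k \<circ> \<phi> \<in> lip_space \<beta>" for k using Y[OF FX[of k]] by blast
  have Fn: "lip_norm \<alpha> (F k) \<le> 2" for k
  proof (cases "k \<ge> 1")
    case True
    then have "lip_norm \<alpha> (F k) \<le> 2 * k powr - \<alpha> * k powr \<alpha>"
      unfolding F_def using lip_norm_power_le[OF True, of "complex_of_real (k powr - \<alpha>)"] by simp
    also have "\<dots> = 2" using True by (simp add: powr_minus)
    finally show ?thesis .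
  next
    case False
    then have k: "k = 0" by simp
    \<comment> \<open>The default \<open>0 powr (- \<alpha>) = 0\<close> makes \<open>F 0\<close>
      the zero function.\<close>
    have "Sup (lip_quotients \<alpha> (F k)) \<le> 0" "F k 0 = 0"
      unfolding F_def k using power_in_X(2)[of 0 0] by simp_all
    then show ?thesis by (simp add: lip_norm_def)
  qed
  have pY: "(\<lambda>z. \<phi> z ^ k) \<in> lip_space \<beta>" for k
    using Y[OF power_in_X(1)[of 1 k]] by (simp add: o_def)
  have bl: "bloch_norm \<omega> (\<lambda>z. \<phi> z ^ k) \<le> ennreal (2 * lip_norm \<beta> (\<lambda>z. \<phi> z ^ k))" for k
    by (rule bloch_norm_le_lip_norm[OF power_cn_holomorphic pY])
  show "\<forall>k\<ge>1. bloch_norm \<omega> (\<lambda>z. \<phi> z ^ k) < \<infinity>"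
  proof (intro allI impI)
    show "bloch_norm \<omega> (\<lambda>z. \<phi> z ^ k) < \<infinity>" for k
      by (rule le_less_trans[OF bl]) simp
  qed
  define a where "a = (\<lambda>k. lip_norm \<beta> (F k \<circ> \<phi>))"
  have a0: "a k \<ge> 0" for k unfolding a_def by (rule lip_norm_bounds(3)[OF FY])
  have scale: "k powr - \<alpha> * lip_norm \<beta> (\<lambda>z. \<phi> z ^ k) \<le> a k" if k: "k \<ge> 1" for k :: nat
  proof -
    define c where "c = real k powr - \<alpha>"
    have c: "c > 0" using k by (simp add: c_def)
    have "Sup (lip_quotients \<beta> (\<lambda>z. \<phi> z ^ k)) \<le> Sup (lip_quotients \<beta> (F k \<circ> \<phi>)) / c"
    proof (rule lip_spaceI)
      show "continuous_on (ball 0 1) (\<lambda>z. \<phi> z ^ k)" by (rule cn_holomorphic_imp_continuous_on[OF power_cn_holomorphic])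
      fix z w :: "complex ^ 'n" assume zw: "z \<in> ball 0 1" "w \<in> ball 0 1"
      have "c * norm (\<phi> z ^ k - \<phi> w ^ k) = norm ((F k \<circ> \<phi>) z - (F k \<circ> \<phi>) w)"
        using c by (simp add: F_def norm_mult flip: c_def right_diff_distrib)
      also have "\<dots> \<le> Sup (lip_quotients \<beta> (F k \<circ> \<phi>)) * norm (z - w) powr \<beta>"
        by (rule lip_space_bound[OF FY zw])
      finally show "norm (\<phi> z ^ k - \<phi> w ^ k) \<le> Sup (lip_quotients \<beta> (F k \<circ> \<phi>)) / c * norm (z - w) powr \<beta>"
        using c by (simp add: field_simps)
    qed
    then have "c * Sup (lip_quotients \<beta> (\<lambda>z. \<phi> z ^ k)) \<le> Sup (lip_quotients \<beta> (F k \<circ> \<phi>))"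
      using c by (simp add: field_simps)
    moreover have "norm ((F k \<circ> \<phi>) 0) = c * norm (\<phi> 0 ^ k)" using c by (simp add: F_def norm_mult flip: c_def)
    ultimately show ?thesis by (simp add: a_def lip_norm_def distrib_left flip: c_def)
  qed
  have sb: "scaled_bloch k \<le> ennreal (2 * a k)" if k: "k \<ge> 1" for k
  proof -
    have "scaled_bloch k \<le> ennreal (k powr - \<alpha>) * ennreal (2 * lip_norm \<beta> (\<lambda>z. \<phi> z ^ k))"
      by (intro mult_left_mono bl) auto
    also have "\<dots> = ennreal (k powr - \<alpha> * (2 * lip_norm \<beta> (\<lambda>z. \<phi> z ^ k)))"
      using lip_norm_bounds(3)[OF pY] by (simp add: ennreal_mult)
    also have "\<dots> \<le> ennreal (2 * a k)" using scale[OF k] by (intro ennreal_leI) simp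
    finally show ?thesis .
  qed
  have F0: "(\<lambda>k. F k w) \<longlonglongrightarrow> 0" if w: "w \<in> ball 0 1" for w
  proof (rule tendsto_norm_zero_cancel, rule tendsto_sandwich[of "\<lambda>_. 0" _ _ "\<lambda>k. norm w ^ k"])
    show "\<forall>\<^sub>F k in sequentially. norm (F k w) \<le> norm w ^ k"
    proof (rule eventually_sequentiallyI[of 1])
      fix k :: nat assume k: "k \<ge> 1"
      have "real k powr - \<alpha> \<le> real k powr 0" using k \<alpha> by (intro powr_mono) auto
      then have "real k powr - \<alpha> * norm w ^ k \<le> 1 * norm w ^ k" using k by (intro mult_right_mono) auto
      then show "norm (F k w) \<le> norm w ^ k" by (simp add: F_def norm_mult norm_power)
    qed
    show "(\<lambda>k. norm w ^ k) \<longlonglongrightarrow> 0" using w by (intro LIMSEQ_power_zero) simp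
  qed auto
  \<comment> \<open>Compactness yields only subsequences. If \<open>a\<close> stayed at least
    \<open>e\<close> along a subsequence, the images along a further one would converge in norm;
    their limit vanishes on the ball, so these norms would tend to 0.\<close>
  have "a \<longlonglongrightarrow> 0"
  proof (rule ccontr)
    assume "\<not> a \<longlonglongrightarrow> 0"
    then obtain e where e: "e > 0" and inf: "\<And>N. \<exists>n\<ge>N. \<not> norm (a n - 0) < e"
      unfolding LIMSEQ_iff by blast
    have "infinite {n. a n \<ge> e}"
      unfolding infinite_nat_iff_unbounded_le
    proof
      fix N
      obtain n where "n \<ge> N" "\<not> norm (a n - 0) < e" using inf by blast
      then have "n \<ge> N" "n \<in> {n. a n \<ge> e}" using a0[of n] by auto
      then show "\<exists>n\<ge>N. n \<in> {n. a n \<ge> e}" by blast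
    qed
    then obtain s :: "nat \<Rightarrow> nat" where s: "strict_mono s" "\<And>n. a (s n) \<ge> e"
      using infinite_enumerate by blast
    have "(\<forall>j. (F \<circ> s) j \<in> X) \<and> (\<exists>M. \<forall>j. lip_norm \<alpha> ((F \<circ> s) j) \<le> M)"
      using FX Fn by (auto intro!: exI[of _ 2])
    then obtain r :: "nat \<Rightarrow> nat" and g where r: "strict_mono r" and g: "g \<in> Y"
      and lim: "(\<lambda>j. lip_norm \<beta> (\<lambda>z. comp_operator \<phi> ((F \<circ> s) (r j)) z - g z)) \<longlonglongrightarrow> 0"
      using comp unfolding compact_operator_def by blast
    define t where "t = s \<circ> r"
    have t: "strict_mono t" unfolding t_def using s(1) r by (rule strict_mono_o)
    have lim: "(\<lambda>j. lip_norm \<beta> (\<lambda>z. (F (t j) \<circ> \<phi>) z - g z)) \<longlonglongrightarrow> 0"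
      using lim by (simp add: comp_operator_def t_def)
    \<comment> \<open>Norm convergence forces pointwise convergence, and the test functions tend to
      0 at \<open>\<phi> z\<close>. This determines \<open>g\<close> only on the ball, but the norm
      sees nothing else.\<close>
    have g0: "g z = 0" if z: "z \<in> ball 0 1" for z
    proof -
      have "(\<lambda>j. (F (t j) \<circ> \<phi>) z - g z) \<longlonglongrightarrow> 0"
      proof (rule Lim_null_comparison[OF _ lim], rule always_eventually, rule allI)
        fix j
        have "(\<lambda>z. (F (t j) \<circ> \<phi>) z - g z) \<in> lip_space \<beta>"
          using g by (intro lip_space_diff FY) auto
        from lip_norm_bound[OF this z] show "norm ((F (t j) \<circ> \<phi>) z - g z) \<le> lip_norm \<beta> (\<lambda>z. (F (t j) \<circ> \<phi>) z - g z)"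
          using \<beta> by simp
      qed
      moreover have "(\<lambda>j. (F (t j) \<circ> \<phi>) z - g z) \<longlonglongrightarrow> 0 - g z"
        using LIMSEQ_subseq_LIMSEQ[OF F0[OF \<phi>_in[OF z]] t] by (intro tendsto_diff) (simp_all add: o_def)
      ultimately show ?thesis using LIMSEQ_unique by fastforce
    qed
    have "lip_norm \<beta> (\<lambda>z. (F (t j) \<circ> \<phi>) z - g z) = a (t j)" for j
      unfolding a_def by (rule lip_norm_cong) (simp only: g0 diff_zero)
    then have "(\<lambda>j. a (t j)) \<longlonglongrightarrow> 0" using lim by simp
    then have "\<forall>\<^sub>F j in sequentially. a (t j) < e" by (rule order_tendstoD(2)[OF _ e])
    then obtain j where "a (t j) < e" unfolding eventually_sequentially by blast
    with s(2)[of "r j"] show False by (simp add: t_def)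
  qed
  then have "(\<lambda>k. ennreal (2 * a k)) \<longlonglongrightarrow> ennreal (2 * 0)"
    by (intro tendsto_ennrealI tendsto_mult tendsto_const)
  then have lim2: "(\<lambda>k. ennreal (2 * a k)) \<longlonglongrightarrow> 0" by simp
  show "scaled_bloch \<longlonglongrightarrow> 0"
    by (rule tendsto_sandwich[OF _ _ tendsto_const lim2])
       (auto intro!: eventually_sequentiallyI[of 1] sb)
qed

text \<open>The summands are returned with their limits because locally uniform convergence of
  holomorphic functions passes to their derivatives, and these drive the estimates for the
  composition.\<close>

lemma bounded_sequence_subsequence:
  assumes F: "\<And>j. F j \<in> X" and M: "\<And>j. lip_norm \<alpha> (F j) \<le> M"
  obtains r :: "nat \<Rightarrow> nat" and h g :: "nat \<Rightarrow> complex \<Rightarrow> complex" and h0 g0 f where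
    "strict_mono r"
    "\<And>j. h j holomorphic_on ball 0 1" "\<And>j. g j holomorphic_on ball 0 1"
    "\<And>j z. z \<in> ball 0 1 \<Longrightarrow> F (r j) z = h j z + cnj (g j z)"
    "h0 holomorphic_on ball 0 1" "g0 holomorphic_on ball 0 1"
    "\<And>z. f z = h0 z + cnj (g0 z)"
    "\<And>K. compact K \<Longrightarrow> K \<subseteq> ball 0 1 \<Longrightarrow> uniform_limit K h h0 sequentially"
    "\<And>K. compact K \<Longrightarrow> K \<subseteq> ball 0 1 \<Longrightarrow> uniform_limit K g g0 sequentially"
    "\<And>z. z \<in> ball 0 1 \<Longrightarrow> (\<lambda>j. F (r j) z) \<longlonglongrightarrow> f z"
    "f \<in> X" "Sup (lip_quotients \<alpha> f) \<le> M"
proof -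
  have M0: "M \<ge> 0" using M[of 0] lip_norm_bounds(3)[of "F 0" \<alpha>] F[of 0] by auto
  have FM: "norm (F j z - F j w) \<le> M * norm (z - w) powr \<alpha>" if "z \<in> ball 0 1" "w \<in> ball 0 1" for j z w
  proof -
    have j: "F j \<in> lip_space \<alpha>" using F[of j] by simp
    have "Sup (lip_quotients \<alpha> (F j)) \<le> M" by (rule order.trans[OF lip_norm_bounds(2)[OF j] M])
    then show ?thesis by (intro order.trans[OF lip_space_bound[OF j that]] mult_right_mono) auto
  qed
  have "\<exists>h g. h holomorphic_on ball 0 1 \<and> g holomorphic_on ball 0 1 \<and> g 0 = 0 \<and>
      (\<forall>z\<in>ball 0 1. F j z = h z + cnj (g z))" for j
  proof -
    have "harmonic_on (F j) (ball 0 1)" using F[of j] by (simp add: PH_disc_def)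
    then show ?thesis by (rule harmonic_normalized_decomposition) blast
  qed
  then obtain h g where h: "\<And>j. h j holomorphic_on ball 0 1" and g: "\<And>j. g j holomorphic_on ball 0 1"
    and gz: "\<And>j. g j 0 = 0" and hg: "\<And>j z. z \<in> ball 0 1 \<Longrightarrow> F j z = h j z + cnj (g j z)"
    by metis
  \<comment> \<open>The uniform bound for Montel's theorem: \<open>M\<close> for the value at 0, and
    the Hardy-Littlewood constant for derivatives growing like
    \<open>8 * M * (1 - norm w) powr (\<alpha> - 1)\<close>.\<close>
  define B where "B = M + (8 * M) * (1 + 2 / \<alpha>)"
  have der: "norm (deriv (h j) w) + norm (deriv (g j) w) \<le> 8 * M * (1 - norm w) powr (\<alpha> - 1)" if "w \<in> ball 0 1" for j w
    by (rule lipschitz_deriv_bound[OF h g hg FM M0 _ that]) (use \<alpha> in auto)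
  have bounded: "norm (p z) \<le> B"
    if p: "p holomorphic_on ball 0 1" and p0: "norm (p 0) \<le> M"
      and dp: "\<And>w. w \<in> ball 0 1 \<Longrightarrow> norm (deriv p w) \<le> 8 * M * (1 - norm w) powr (\<alpha> - 1)"
      and z: "z \<in> ball 0 1" for p :: "complex \<Rightarrow> complex" and z
  proof -
    have "norm (p z - p 0) \<le> (8 * M) * (1 + 2 / \<alpha>) * norm (z - 0) powr \<alpha>"
    proof (rule hardy_littlewood_lipschitz)
      show "(p has_derivative (*) (deriv p z)) (at z)" if "z \<in> ball 0 1" for z
        using holomorphic_derivI[OF p open_ball that] by (simp add: has_field_derivative_def)
      show "norm (deriv p z * v) \<le> 8 * M * (1 - norm z) powr (\<alpha> - 1) * norm v" if "z \<in> ball 0 1" for z v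
        unfolding norm_mult by (intro mult_right_mono dp that) auto
    qed (use M0 \<alpha> z in auto)
    also have "\<dots> \<le> (8 * M) * (1 + 2 / \<alpha>) * 1"
      using z \<alpha> M0 powr_mono2[of \<alpha> "norm z" 1] by (intro mult_left_mono) auto
    finally show ?thesis using p0 norm_triangle_sub[of "p z" "p 0"] by (simp add: B_def)
  qed
  define H where "H = {p. p holomorphic_on ball (0::complex) 1 \<and> (\<forall>z\<in>ball 0 1. norm (p z) \<le> B)}"
  have H1: "p holomorphic_on ball 0 1" if "p \<in> H" for p using that by (simp add: H_def)
  have H2: "\<exists>B. \<forall>p\<in>H. \<forall>z\<in>K. norm (p z) \<le> B" if "compact K" "K \<subseteq> ball 0 1" for K
    using that unfolding H_def by blast
  have h0: "norm (h j 0) \<le> M" for j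
  proof -
    have "norm (F j 0) \<le> M" using lip_norm_bounds(1)[of "F j" \<alpha>] F[of j] M[of j] by auto
    then show ?thesis using hg[of 0 j] gz[of j] by simp
  qed
  have hH: "h j \<in> H" for j
  proof -
    have "norm (deriv (h j) w) \<le> 8 * M * (1 - norm w) powr (\<alpha> - 1)" if "w \<in> ball 0 1" for w
      using der[OF that, of j] norm_ge_zero[of "deriv (g j) w"] by linarith
    then show ?thesis unfolding H_def using bounded[OF h h0] h by blast
  qed
  have gH: "g j \<in> H" for j
  proof -
    have "norm (deriv (g j) w) \<le> 8 * M * (1 - norm w) powr (\<alpha> - 1)" if "w \<in> ball 0 1" for w
      using der[OF that, of j] norm_ge_zero[of "deriv (h j) w"] by linarith
    moreover have "norm (g j 0) \<le> M" using gz M0 by simp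
    ultimately show ?thesis unfolding H_def using bounded[OF g] g by blast
  qed
  obtain h' r1 where h': "h' holomorphic_on ball 0 1" and r1: "strict_mono (r1 :: nat \<Rightarrow> nat)"
    and h'l: "\<And>x. x \<in> ball 0 1 \<Longrightarrow> ((\<lambda>n. h (r1 n) x) \<longlongrightarrow> h' x) sequentially"
    and h'u: "\<And>K. \<lbrakk>compact K; K \<subseteq> ball 0 1\<rbrakk> \<Longrightarrow> uniform_limit K (h \<circ> r1) h' sequentially"
    by (rule Montel[OF open_ball H1 H2, of h]) (use hH in auto)
  \<comment> \<open>The second extraction runs along the first subsequence, so both families
    converge along \<open>r1 \<circ> r2\<close>.\<close>
  obtain g' r2 where g': "g' holomorphic_on ball 0 1" and r2: "strict_mono (r2 :: nat \<Rightarrow> nat)"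
    and g'l: "\<And>x. x \<in> ball 0 1 \<Longrightarrow> ((\<lambda>n. (g \<circ> r1) (r2 n) x) \<longlongrightarrow> g' x) sequentially"
    and g'u: "\<And>K. \<lbrakk>compact K; K \<subseteq> ball 0 1\<rbrakk> \<Longrightarrow> uniform_limit K ((g \<circ> r1) \<circ> r2) g' sequentially"
    by (rule Montel[OF open_ball H1 H2, of "g \<circ> r1"]) (use gH in auto)
  define r where "r = r1 \<circ> r2"
  define f where "f = (\<lambda>z. h' z + cnj (g' z))"
  have r: "strict_mono r" unfolding r_def using r1 r2 by (rule strict_mono_o)
  have hu: "uniform_limit K (\<lambda>j. h (r j)) h' sequentially" if "compact K" "K \<subseteq> ball 0 1" for K
    using filterlim_compose[OF h'u[OF that] filterlim_subseq[OF r2]] by (simp add: o_def r_def)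
  have gu: "uniform_limit K (\<lambda>j. g (r j)) g' sequentially" if "compact K" "K \<subseteq> ball 0 1" for K
    using g'u[OF that] by (simp add: o_def r_def)
  have hl: "(\<lambda>j. h (r j) z) \<longlonglongrightarrow> h' z" if "z \<in> ball 0 1" for z
    using LIMSEQ_subseq_LIMSEQ[OF h'l[OF that] r2] by (simp add: o_def r_def)
  have gl: "(\<lambda>j. g (r j) z) \<longlonglongrightarrow> g' z" if "z \<in> ball 0 1" for z
    using g'l[OF that] by (simp add: o_def r_def)
  have fl: "(\<lambda>j. F (r j) z) \<longlonglongrightarrow> f z" if z: "z \<in> ball 0 1" for z
  proof -
    have "(\<lambda>j. h (r j) z + cnj (g (r j) z)) \<longlonglongrightarrow> f z"
      unfolding f_def by (intro tendsto_intros hl[OF z] gl[OF z])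
    then show ?thesis by (simp only: hg[OF z])
  qed
  have cf: "continuous_on (ball 0 1) f"
    unfolding f_def by (intro continuous_intros holomorphic_on_imp_continuous_on h' g')
  \<comment> \<open>The Lipschitz inequality is closed under pointwise limits, so \<open>f\<close>
    inherits the constant \<open>M\<close>.\<close>
  have bf: "norm (f z - f w) \<le> M * norm (z - w) powr \<alpha>" if zw: "z \<in> ball 0 1" "w \<in> ball 0 1" for z w
    by (rule LIMSEQ_le_const2[OF tendsto_norm[OF tendsto_diff[OF fl[OF zw(1)] fl[OF zw(2)]]]])
       (use FM[OF zw] in auto)
  have "harmonic_on f (ball 0 1)"
    by (rule harmonic_on_holomorphic_plus_cnj[OF open_ball h' g']) (simp add: f_def)
  then have f: "f \<in> PH_disc" by (simp add: PH_disc_def)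
  show ?thesis
  proof (rule that[of r "\<lambda>j. h (r j)" "\<lambda>j. g (r j)" h' g' f])
    show "f \<in> X" using f lip_spaceI(1)[OF cf bf] by blast
    show "Sup (lip_quotients \<alpha> f) \<le> M" by (rule lip_spaceI(2)[OF cf bf])
    show "f z = h' z + cnj (g' z)" for z by (simp add: f_def)
  qed (fact r h g hg h' g' hu gu fl)+
qed

text \<open>After extraction, the ball is split at \<open>norm (\<phi> z) = 1 - \<delta>\<close>.
  Beyond it the derivatives of the summands of \<open>d j\<close> obey a growth bound uniform in
  \<open>j\<close>, and the weighted derivative of \<phi> is small. Below it these derivatives are
  uniformly small for large \<open>j\<close>, and \<open>D z\<close> is bounded by a multiple of
  \<open>W z\<close>.\<close>

lemma limit_imp_compact:
  assumes fin: "\<forall>k\<ge>1. bloch_norm \<omega> (\<lambda>z. \<phi> z ^ k) < \<infinity>" and lim: "scaled_bloch \<longlonglongrightarrow> 0"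
  shows "compact_operator X (lip_norm \<alpha>) Y (lip_norm \<beta>) (comp_operator \<phi>)"
proof -
  have fin': "scaled_bloch k < \<infinity>" if "k \<ge> 1" for k
    using fin that by (simp add: ennreal_mult_less_top)
  obtain c where c: "c \<ge> 0" "\<And>k. k \<ge> 1 \<Longrightarrow> scaled_bloch k \<le> ennreal c"
    using ennreal_bounded_of_tendsto_0[OF fin' lim] by blast
  define C where "C = 2 * exp 1 * c"
  have C0: "C \<ge> 0" using c by (simp add: C_def)
  have C: "(1 - norm (\<phi> z)) powr (\<alpha> - 1) * norm (D z v) \<le> C * W z * norm v" if "z \<in> ball 0 1" for z v
    unfolding C_def by (rule weighted_derivative_bound[of 0, OF c(2) c(1) that]) simp_all
  \<comment> \<open>The weight \<open>(1 - norm (\<phi> z)) powr (\<alpha> - 1)\<close> is at least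
    1 and may be dropped; this is the estimate used where \<open>\<phi> z\<close> stays away from
    the circle.\<close>
  have DC: "norm (D z v) \<le> C * W z * norm v" if z: "z \<in> ball 0 1" for z v
  proof -
    have "(1 - norm (\<phi> z)) powr 0 \<le> (1 - norm (\<phi> z)) powr (\<alpha> - 1)"
      using \<phi>_in[OF z] \<alpha> by (intro powr_mono') auto
    then have "1 * norm (D z v) \<le> (1 - norm (\<phi> z)) powr (\<alpha> - 1) * norm (D z v)"
      using \<phi>_in[OF z] by (intro mult_right_mono) auto
    also have "\<dots> \<le> C * W z * norm v" by (rule C[OF z])
    finally show ?thesis by simp
  qed
  have Y: "f \<circ> \<phi> \<in> Y" if "f \<in> X" for f
    by (rule compose_in_Y(1)[OF C C0 that])
  have small: "\<exists>\<delta>>0. \<delta> < 1 \<and> (\<forall>z\<in>ball 0 1. \<forall>v. norm (\<phi> z) > 1 - \<delta> \<longrightarrow>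
      (1 - norm (\<phi> z)) powr (\<alpha> - 1) * norm (D z v) \<le> e * W z * norm v)" if e: "e > 0" for e
  proof -
    define \<epsilon> where "\<epsilon> = e / (2 * exp 1)"
    have \<epsilon>: "\<epsilon> > 0" "2 * exp 1 * \<epsilon> = e" using e by (simp_all add: \<epsilon>_def)
    have "\<forall>\<^sub>F k in sequentially. scaled_bloch k < ennreal \<epsilon>"
      by (rule order_tendstoD(2)[OF lim]) (use \<epsilon> in simp)
    then obtain k0 where k0: "\<And>k. k \<ge> k0 \<Longrightarrow> scaled_bloch k < ennreal \<epsilon>"
      unfolding eventually_sequentially by blast
    \<comment> \<open>Chosen so that \<open>norm (\<phi> z) > 1 - \<delta>\<close> entails the
      closeness condition for \<open>k0\<close>; the summand 1 covers \<open>k0 = 0\<close>.\<close>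
    define \<delta> where "\<delta> = 1 / (2 * (real k0 + 1))"
    have \<delta>: "\<delta> > 0" "\<delta> < 1" by (simp_all add: \<delta>_def)
    have "(1 - norm (\<phi> z)) powr (\<alpha> - 1) * norm (D z v) \<le> e * W z * norm v"
      if z: "z \<in> ball 0 1" and n: "norm (\<phi> z) > 1 - \<delta>" for z v
    proof -
      have "2 * k0 * (1 - norm (\<phi> z)) \<le> 2 * (real k0 + 1) * \<delta>"
        using n \<phi>_in[OF z] by (intro mult_mono) auto
      also have "\<dots> = 1" by (simp add: \<delta>_def)
      finally have "k0 \<le> 1 \<or> 2 * k0 * (1 - norm (\<phi> z)) \<le> 1" by blast
      moreover have "scaled_bloch k \<le> ennreal \<epsilon>" if "k \<ge> k0" for k
        using k0[OF that] by (rule less_imp_le)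
      ultimately show ?thesis using \<epsilon> z
        by (subst \<epsilon>(2)[symmetric]) (rule weighted_derivative_bound[of k0], simp_all)
    qed
    then show ?thesis using \<delta> by blast
  qed
  show ?thesis unfolding compact_operator_def
  proof (intro conjI allI impI)
    show "linear_operator X Y (comp_operator \<phi>)" by (rule linear_operator_comp[OF Y])
    fix F :: "nat \<Rightarrow> complex \<Rightarrow> complex" assume "(\<forall>j. F j \<in> X) \<and> (\<exists>M. \<forall>j. lip_norm \<alpha> (F j) \<le> M)"
    then obtain M where F: "\<And>j. F j \<in> X" and M: "\<And>j. lip_norm \<alpha> (F j) \<le> M" by blast
    obtain r :: "nat \<Rightarrow> nat" and h g :: "nat \<Rightarrow> complex \<Rightarrow> complex" and h0 g0 f where r: "strict_mono r"
      and h: "\<And>j. h j holomorphic_on ball 0 1" and g: "\<And>j. g j holomorphic_on ball 0 1"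
      and hg: "\<And>j z. z \<in> ball 0 1 \<Longrightarrow> F (r j) z = h j z + cnj (g j z)"
      and h0: "h0 holomorphic_on ball 0 1" and g0: "g0 holomorphic_on ball 0 1"
      and f: "\<And>z. f z = h0 z + cnj (g0 z)"
      and hu: "\<And>K. compact K \<Longrightarrow> K \<subseteq> ball 0 1 \<Longrightarrow> uniform_limit K h h0 sequentially"
      and gu: "\<And>K. compact K \<Longrightarrow> K \<subseteq> ball 0 1 \<Longrightarrow> uniform_limit K g g0 sequentially"
      and fl: "\<And>z. z \<in> ball 0 1 \<Longrightarrow> (\<lambda>j. F (r j) z) \<longlonglongrightarrow> f z"
      and fX: "f \<in> X" and fM: "Sup (lip_quotients \<alpha> f) \<le> M"
      using bounded_sequence_subsequence[of F M, OF F M] by blast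
    have M0: "M \<ge> 0" using M[of 0] lip_norm_bounds(3)[of "F 0" \<alpha>] F[of 0] by auto
    define d where "d = (\<lambda>j z. F (r j) z - f z)"
    define dh where "dh = (\<lambda>j z. h j z - h0 z)"
    define dg where "dg = (\<lambda>j z. g j z - g0 z)"
    have dh: "dh j holomorphic_on ball 0 1" and dg: "dg j holomorphic_on ball 0 1" for j
      unfolding dh_def dg_def by (intro holomorphic_intros h g h0 g0)+
    have d: "d j z = dh j z + cnj (dg j z)" if "z \<in> ball 0 1" for j z
      by (simp add: d_def dh_def dg_def hg[OF that] f)
    have dX: "d j \<in> lip_space \<alpha>" for j
      unfolding d_def using F fX by (intro lip_space_diff) auto
    have dS: "Sup (lip_quotients \<alpha> (d j)) \<le> 2 * M" for j
    proof -
      have "Sup (lip_quotients \<alpha> (d j)) \<le> Sup (lip_quotients \<alpha> (F (r j))) + Sup (lip_quotients \<alpha> f)"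
        unfolding d_def using F fX by (intro lip_space_diff) auto
      moreover have "Sup (lip_quotients \<alpha> (F (r j))) \<le> M"
        using lip_norm_bounds(2)[of "F (r j)" \<alpha>] F[of "r j"] M[of "r j"] by auto
      ultimately show ?thesis using fM by linarith
    qed
    have dM: "norm (d j z - d j w) \<le> 2 * M * norm (z - w) powr \<alpha>" if "z \<in> ball 0 1" "w \<in> ball 0 1" for j z w
      by (rule order.trans[OF lip_space_bound[OF dX that] mult_right_mono[OF dS]]) simp
    have dder: "norm (deriv (dh j) w) + norm (deriv (dg j) w) \<le> 8 * (2 * M) * (1 - norm w) powr (\<alpha> - 1)"
      if "w \<in> ball 0 1" for j w
      by (rule lipschitz_deriv_bound[OF dh dg d dM _ _ that]) (use M0 \<alpha> in auto)
    have dunif: "\<forall>\<^sub>F j in sequentially. \<forall>w\<in>cball 0 (1 - \<delta>). norm (deriv (dh j) w) + norm (deriv (dg j) w) \<le> e"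
      if \<delta>: "\<delta> > 0" "\<delta> < 1" and e: "e > 0" for \<delta> e
    proof -
      \<comment> \<open>\<open>K\<close> exceeds the disc of radius \<open>1 - \<delta>\<close> by
        \<open>\<delta> / 2\<close>, which is the room for Cauchy's inequality. With
        \<open>\<eta>\<close> as below each of the two derivatives is at most
        \<open>2 * \<eta> / (\<delta> / 2) = e / 2\<close>.\<close>
      define K where "K = cball (0::complex) (1 - \<delta> / 2)"
      have K: "compact K" "K \<subseteq> ball 0 1" using \<delta> by (auto simp: K_def)
      define \<eta> where "\<eta> = e * \<delta> / 8"
      have \<eta>: "\<eta> > 0" using e \<delta> by (simp add: \<eta>_def)
      have "\<forall>\<^sub>F j in sequentially. \<forall>w\<in>K. dist (h j w) (h0 w) < \<eta>"
        using hu[OF K] \<eta> unfolding uniform_limit_iff by blast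
      moreover have "\<forall>\<^sub>F j in sequentially. \<forall>w\<in>K. dist (g j w) (g0 w) < \<eta>"
        using gu[OF K] \<eta> unfolding uniform_limit_iff by blast
      ultimately show ?thesis
      proof eventually_elim
        case (elim j)
        show ?case
        proof
          fix w :: complex assume w: "w \<in> cball 0 (1 - \<delta>)"
          have sub: "ball w (\<delta> / 2) \<subseteq> K"
          proof
            fix x assume "x \<in> ball w (\<delta> / 2)"
            then show "x \<in> K" using w dist_triangle[of 0 x w] by (simp add: K_def)
          qed
          have "norm (deriv (dh j) w) \<le> 2 * \<eta> / (\<delta> / 2)"
          proof (rule norm_deriv_le_of_bounded)
            show "dh j holomorphic_on ball w (\<delta> / 2)" using dh sub K by (meson holomorphic_on_subset subset_trans)
            show "norm (dh j z) \<le> \<eta>" if "z \<in> ball w (\<delta> / 2)" for z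
            proof -
              have "dist (h j z) (h0 z) < \<eta>" using elim(1) sub that by blast
              then show ?thesis by (simp add: dh_def dist_norm)
            qed
          qed (use \<delta> in simp)
          moreover have "norm (deriv (dg j) w) \<le> 2 * \<eta> / (\<delta> / 2)"
          proof (rule norm_deriv_le_of_bounded)
            show "dg j holomorphic_on ball w (\<delta> / 2)" using dg sub K by (meson holomorphic_on_subset subset_trans)
            show "norm (dg j z) \<le> \<eta>" if "z \<in> ball w (\<delta> / 2)" for z
            proof -
              have "dist (g j z) (g0 z) < \<eta>" using elim(2) sub that by blast
              then show ?thesis by (simp add: dg_def dist_norm)
            qed
          qed (use \<delta> in simp)
          moreover have "2 * \<eta> / (\<delta> / 2) = e / 2" using \<delta> by (simp add: \<eta>_def)
          ultimately show "norm (deriv (dh j) w) + norm (deriv (dg j) w) \<le> e" by linarith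
        qed
      qed
    qed
    have semi: "\<forall>\<^sub>F j in sequentially. Sup (lip_quotients \<beta> (d j \<circ> \<phi>)) \<le> e * (1 + 2 / \<beta>)" if e: "e > 0" for e
    proof -
      \<comment> \<open>The 16 is the growth constant 8 times the 2 in the seminorm bound
        \<open>2 * M\<close> of a difference. Adding 1 avoids division by 0 when
        \<open>M = 0\<close>, and likewise in \<open>e2\<close> when \<open>C = 0\<close>.\<close>
      define e1 where "e1 = e / (16 * M + 1)"
      have e1: "e1 > 0" "16 * M * e1 \<le> e" using e M0 by (auto simp: e1_def add_nonneg_pos divide_simps)
      obtain \<delta> where \<delta>: "\<delta> > 0" "\<delta> < 1" and near: "\<And>z v. z \<in> ball 0 1 \<Longrightarrow> norm (\<phi> z) > 1 - \<delta> \<Longrightarrow>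
         (1 - norm (\<phi> z)) powr (\<alpha> - 1) * norm (D z v) \<le> e1 * W z * norm v"
        using small[OF e1(1)] by blast
      define e2 where "e2 = e / (C + 1)"
      have e2: "e2 > 0" "e2 * C \<le> e" using e C0 by (auto simp: e2_def add_nonneg_pos divide_simps)
      show ?thesis using dunif[OF \<delta> e2(1)]
      proof eventually_elim
        case (elim j)
        have bd: "(norm (deriv (dh j) (\<phi> z)) + norm (deriv (dg j) (\<phi> z))) * norm (D z v) \<le> e * W z * norm v"
          if z: "z \<in> ball 0 1" for z v
        proof (cases "norm (\<phi> z) > 1 - \<delta>")
          case True
          have "(norm (deriv (dh j) (\<phi> z)) + norm (deriv (dg j) (\<phi> z))) * norm (D z v)
              \<le> 8 * (2 * M) * (1 - norm (\<phi> z)) powr (\<alpha> - 1) * norm (D z v)"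
            by (intro mult_right_mono dder \<phi>_in z) auto
          also have "\<dots> = 16 * M * ((1 - norm (\<phi> z)) powr (\<alpha> - 1) * norm (D z v))" by simp
          also have "\<dots> \<le> 16 * M * (e1 * W z * norm v)"
            using M0 by (intro mult_left_mono near z True) auto
          also have "\<dots> = 16 * M * e1 * (W z * norm v)" by simp
          also have "\<dots> \<le> e * (W z * norm v)" by (intro mult_right_mono e1) auto
          finally show ?thesis by (simp add: mult.assoc)
        next
          case False
          then have "(norm (deriv (dh j) (\<phi> z)) + norm (deriv (dg j) (\<phi> z))) * norm (D z v) \<le> e2 * norm (D z v)"
            using elim by (intro mult_right_mono) auto
          also have "\<dots> \<le> e2 * (C * W z * norm v)" using e2 by (intro mult_left_mono DC z) auto
          also have "\<dots> = e2 * C * (W z * norm v)" by simp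
          also have "\<dots> \<le> e * (W z * norm v)" by (intro mult_right_mono e2) auto
          finally show ?thesis by (simp add: mult.assoc)
        qed
        show ?case
          by (rule lip_spaceI(2)[OF compose_continuous[OF dh dg d] compose_lipschitz[OF dh dg d bd]])
             (use e in auto)
      qed
    qed
    have dY: "d j \<circ> \<phi> \<in> lip_space \<beta>" for j
      using lip_space_diff(1)[of "F (r j) \<circ> \<phi>" \<beta> "f \<circ> \<phi>"] Y[OF F[of "r j"]] Y[OF fX]
      by (simp add: d_def o_def)
    have "(\<lambda>j. lip_norm \<beta> (d j \<circ> \<phi>)) \<longlonglongrightarrow> 0"
    proof (rule tendstoI)
      fix e :: real assume e: "e > 0"
      \<comment> \<open>The seminorm takes at most \<open>e' * (1 + 2 / \<beta>) = e / 4\<close>,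
        and the value of \<open>d j \<circ> \<phi>\<close> at 0 takes less than
        \<open>e / 2\<close>.\<close>
      define e' where "e' = e / (4 * (1 + 2 / \<beta>))"
      have e': "e' > 0" "e' * (1 + 2 / \<beta>) < e / 2" using e \<beta> by (simp_all add: e'_def add_pos_pos divide_simps)
      have "(\<lambda>j. F (r j) (\<phi> 0) - f (\<phi> 0)) \<longlonglongrightarrow> 0"
        by (intro LIM_zero fl \<phi>_in) simp
      then have "\<forall>\<^sub>F j in sequentially. norm (F (r j) (\<phi> 0) - f (\<phi> 0)) < e / 2"
        using e unfolding tendsto_iff by (auto dest: spec[of _ "e/2"])
      with semi[OF e'(1)] show "\<forall>\<^sub>F j in sequentially. dist (lip_norm \<beta> (d j \<circ> \<phi>)) 0 < e"
      proof eventually_elim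
        case (elim j)
        have "norm ((d j \<circ> \<phi>) 0) < e / 2" using elim(2) by (simp add: d_def)
        then have "lip_norm \<beta> (d j \<circ> \<phi>) < e" unfolding lip_norm_def using elim(1) e'(2) by linarith
        then show ?case using lip_norm_bounds(3)[OF dY[of j]] by (simp add: dist_norm)
      qed
    qed
    then show "\<exists>r g. strict_mono r \<and> g \<in> Y \<and> (\<lambda>j. lip_norm \<beta> (\<lambda>z. comp_operator \<phi> (F (r j)) z - g z)) \<longlonglongrightarrow> 0"
      using r Y[OF fX] by (intro exI[of _ r] exI[of _ "f \<circ> \<phi>"]) (simp add: comp_operator_def d_def o_def)
  qed
qed

end

theorem theorem1p6:
  fixes \<alpha> \<beta> :: real and \<omega> :: "real \<Rightarrow> real" and \<phi> :: "complex ^ 'n \<Rightarrow> complex"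
  assumes "\<alpha> \<in> {0<..<1}" and "\<beta> \<in> {0<..<1}"
    and "\<And>t. t \<in> {0..<1} \<Longrightarrow> \<omega> t = 1 / (1 - t) powr (1 - \<beta>)"
    and "cn_holomorphic_on \<phi> (ball 0 1)"
    and "\<phi> ` ball 0 1 \<subseteq> ball 0 1"
  shows
    "(bounded_operator (lip_space \<alpha> \<inter> PH_disc) (lip_norm \<alpha>)
        (lip_space \<beta> \<inter> PH_ball) (lip_norm \<beta>) (comp_operator \<phi>)
      \<longleftrightarrow> (SUP k\<in>{1::nat..}. ennreal (real k powr (- \<alpha>)) * bloch_norm \<omega> (\<lambda>z. \<phi> z ^ k)) < \<infinity>)
   \<and> (compact_operator (lip_space \<alpha> \<inter> PH_disc) (lip_norm \<alpha>)
        (lip_space \<beta> \<inter> PH_ball) (lip_norm \<beta>) (comp_operator \<phi>)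
      \<longleftrightarrow> (\<forall>k\<ge>1. bloch_norm \<omega> (\<lambda>z. \<phi> z ^ k) < \<infinity>) \<and>
          (\<lambda>k::nat. ennreal (real k powr (- \<alpha>)) * bloch_norm \<omega> (\<lambda>z. \<phi> z ^ k)) \<longlonglongrightarrow> 0)"
proof -
  interpret lipschitz_composition \<alpha> \<beta> \<omega> \<phi>
    using assms by unfold_locales auto
  show ?thesis
    using bounded_iff compact_imp_limit limit_imp_compact by blast
qed

end
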